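(* The algorithm described in the context is $(1+\sqrt{2})$-competitive for the time-dependent online freeze-tag problem on any strongly connected metric space.
   Context: Time-dependent (online) freeze-tag: robots are points in a strongly connected metric space (for any $x,y$ there is a path from $x$ to $y$ of length $d(x,y)$) and move at speed at most $1$; only active robots move. An instance $\sigma$ is a list $r_i=(p_i,t_i)$, $0=t_0\le t_1\le\cdots\le t_n$, where $r_0$ starts active at $p_0$ at time $0$ and frozen robot $r_i$ at $p_i$ is revealed (position, time and existence) only at time $t_i$; a frozen robot is activated when an active robot visits it at a time $\ge$ its release time. $A(\sigma)$ is the time the algorithm activates the last robot; $OPT(\sigma)$ is the optimal offline completion time; $A$ is $c$-competitive if $A(\sigma)\le c\,OPT(\sigma)$ for all $\sigma$. Let $OPT(j)$ be the optimal completion time of the instance truncated to $r_0,\dots,r_j$. The algorithm: every time a robot $r_j$ is released, the current plan is replaced by: (1) send every active robot $r_i$ back to its starting position $p_i$; (2) wait until time $\sqrt{2}\cdot OPT(j)$; (3) wake up all released robots in time $OPT(j)$ following an optimal schedule; (4) send every robot $r_i$ back to $p_i$ and wait there. *)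

theory Defs
  imports "HOL-Analysis.Analysis"
begin

text \<open>Length of a path with parameter interval \<open>{0..1}\<close>: the supremum of the lengths of inscribed
  polygons, possibly infinite.\<close>

definition path_length :: "(real \<Rightarrow> 'a::metric_space) \<Rightarrow> ereal" where
  "path_length g =
     (SUP ts \<in> {ts. sorted ts \<and> set ts \<subseteq> {0..1}}.
        ereal (\<Sum>k<length ts - 1. dist (g (ts ! k)) (g (ts ! Suc k))))"

definition strongly_connected :: "'a::metric_space set \<Rightarrow> bool" where
  "strongly_connected M \<longleftrightarrow>
     (\<forall>x\<in>M. \<forall>y\<in>M. \<exists>g. path g \<and> path_image g \<subseteq> M \<and> pathstart g = x \<and> pathfinish g = y \<and>
        path_length g = ereal (dist x y))"

text \<open>An instance lists the robots \<open>r\<^sub>0, r\<^sub>1, \<dots>\<close> as pairs of a position and a release time.\<close>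

type_synonym 'a freeze_inst = "('a \<times> real) list"

abbreviation pos :: "'a freeze_inst \<Rightarrow> nat \<Rightarrow> 'a" where
  "pos \<sigma> i \<equiv> fst (\<sigma> ! i)"

abbreviation rel :: "'a freeze_inst \<Rightarrow> nat \<Rightarrow> real" where
  "rel \<sigma> i \<equiv> snd (\<sigma> ! i)"

definition freeze_instance :: "'a freeze_inst \<Rightarrow> bool" where
  "freeze_instance \<sigma> \<longleftrightarrow> \<sigma> \<noteq> [] \<and> rel \<sigma> 0 = 0 \<and> sorted (map snd \<sigma>)"

text \<open>A motion \<open>x\<close> gives the position \<open>x i t\<close> of robot \<open>r\<^sub>i\<close> at time \<open>t\<close>; only \<open>i < length \<sigma>\<close>
  and \<open>t \<ge> 0\<close> are meaningful.\<close>

type_synonym 'a motion = "nat \<Rightarrow> real \<Rightarrow> 'a"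

text \<open>\<open>active \<sigma> x i t\<close>: robot \<open>r\<^sub>i\<close> is active at time \<open>t\<close>.  Activation happens at the first visit of an
  active robot not earlier than the release time.  The least fixed point rules out robots at a
  common position activating each other.\<close>

inductive active :: "'a freeze_inst \<Rightarrow> 'a motion \<Rightarrow> nat \<Rightarrow> real \<Rightarrow> bool"
  for \<sigma> :: "'a freeze_inst" and x :: "'a motion" where
  initial: "0 \<le> t \<Longrightarrow> active \<sigma> x 0 t"
| visited: "\<lbrakk>active \<sigma> x w s; i < length \<sigma>; rel \<sigma> i \<le> s; x w s = pos \<sigma> i; s \<le> t\<rbrakk>
            \<Longrightarrow> active \<sigma> x i t"

definition schedule :: "'a::metric_space freeze_inst \<Rightarrow> 'a motion \<Rightarrow> bool" where
  "schedule \<sigma> x \<longleftrightarrow>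
     (\<forall>i<length \<sigma>. x i 0 = pos \<sigma> i \<and> 1-lipschitz_on {0..} (x i) \<and>
        (\<forall>t\<ge>0. \<not> active \<sigma> x i t \<longrightarrow> x i t = pos \<sigma> i))"

text \<open>The time at which the last robot is activated; \<open>\<infinity>\<close> if some robot is never activated.\<close>

definition completion_time :: "'a freeze_inst \<Rightarrow> 'a motion \<Rightarrow> ereal" where
  "completion_time \<sigma> x = (INF T \<in> {T. 0 \<le> T \<and> (\<forall>i<length \<sigma>. active \<sigma> x i T)}. ereal T)"

definition OPT :: "'a::metric_space freeze_inst \<Rightarrow> ereal" where
  "OPT \<sigma> = (INF x \<in> {x. schedule \<sigma> x}. completion_time \<sigma> x)"

definition optimal_schedule :: "'a::metric_space freeze_inst \<Rightarrow> 'a motion \<Rightarrow> bool" where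
  "optimal_schedule \<sigma> x \<longleftrightarrow> schedule \<sigma> x \<and> completion_time \<sigma> x = OPT \<sigma>"

definition revealed :: "'a freeze_inst \<Rightarrow> real \<Rightarrow> 'a freeze_inst" where
  "revealed \<sigma> t = filter (\<lambda>r. snd r \<le> t) \<sigma>"

text \<open>An online algorithm produces a legal schedule for every instance, and its motions up to time
  \<open>t\<close> depend only on the robots revealed by time \<open>t\<close>.\<close>

definition online_algorithm :: "('a::metric_space freeze_inst \<Rightarrow> 'a motion) \<Rightarrow> bool" where
  "online_algorithm A \<longleftrightarrow>
     (\<forall>\<sigma>. freeze_instance \<sigma> \<longrightarrow> schedule \<sigma> (A \<sigma>)) \<and>
     (\<forall>\<sigma> \<tau> t. freeze_instance \<sigma> \<and> freeze_instance \<tau> \<and> 0 \<le> t \<and> revealed \<sigma> t = revealed \<tau> t \<longrightarrow>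
        (\<forall>i<length (revealed \<sigma> t). \<forall>s\<in>{0..t}. A \<sigma> i s = A \<tau> i s))"

definition competitive :: "real \<Rightarrow> ('a::metric_space freeze_inst \<Rightarrow> 'a motion) \<Rightarrow> bool" where
  "competitive c A \<longleftrightarrow>
     (\<forall>\<sigma>. freeze_instance \<sigma> \<longrightarrow> completion_time \<sigma> (A \<sigma>) \<le> ereal c * OPT \<sigma>)"

text \<open>\<open>G x y s\<close> is the position, \<open>s\<close> time units after departure, of a robot sent from \<open>x\<close> to \<open>y\<close>
  along a shortest path at full speed and waiting at \<open>y\<close> after its arrival.\<close>

definition shortest_moves :: "('a::metric_space \<Rightarrow> 'a \<Rightarrow> real \<Rightarrow> 'a) \<Rightarrow> bool" where
  "shortest_moves G \<longleftrightarrow>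
     (\<forall>x y. G x y 0 = x \<and> (\<forall>s\<ge>dist x y. G x y s = y) \<and> 1-lipschitz_on {0..} (G x y))"

text \<open>The plan adopted at the release of \<open>r\<^sub>j\<close>, with the robots currently at the positions \<open>c\<close>, as a
  motion for times \<open>t \<ge> rel \<sigma> j\<close> and robots \<open>i \<le> j\<close>.  Frozen robots satisfy \<open>c i = pos \<sigma> i\<close>, so
  sending everybody home does not move them.  Waiting until time \<open>sqrt 2 * T\<close> happens only after
  everybody is home, hence the maximum in the starting time \<open>b\<close>: that the robots are back in time
  is not built into the definition.\<close>

definition plan_from ::
  "('a::metric_space freeze_inst \<Rightarrow> 'a motion) \<Rightarrow> ('a \<Rightarrow> 'a \<Rightarrow> real \<Rightarrow> 'a) \<Rightarrow> 'a freeze_inst \<Rightarrow>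
   nat \<Rightarrow> (nat \<Rightarrow> 'a) \<Rightarrow> 'a motion" where
  "plan_from S G \<sigma> j c i t =
     (let \<sigma>' = take (Suc j) \<sigma>;
          T = real_of_ereal (OPT \<sigma>');
          b = max (sqrt 2 * T) (MAX k\<in>{..j}. rel \<sigma> j + dist (c k) (pos \<sigma> k))
      in if t \<le> b then G (c i) (pos \<sigma> i) (t - rel \<sigma> j)
         else if t \<le> b + T then S \<sigma>' i (t - b)
         else G (S \<sigma>' i T) (pos \<sigma> i) (t - (b + T)))"

primrec plan ::
  "('a::metric_space freeze_inst \<Rightarrow> 'a motion) \<Rightarrow> ('a \<Rightarrow> 'a \<Rightarrow> real \<Rightarrow> 'a) \<Rightarrow> 'a freeze_inst \<Rightarrow>
   nat \<Rightarrow> 'a motion" where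
  "plan S G \<sigma> 0 = plan_from S G \<sigma> 0 (pos \<sigma>)"
| "plan S G \<sigma> (Suc j) =
     plan_from S G \<sigma> (Suc j)
       (\<lambda>i. if i \<le> j then plan S G \<sigma> j i (rel \<sigma> (Suc j)) else pos \<sigma> i)"

definition last_released :: "'a freeze_inst \<Rightarrow> real \<Rightarrow> nat" where
  "last_released \<sigma> t = Max {j. j < length \<sigma> \<and> rel \<sigma> j \<le> t}"

text \<open>At every time the plan of the latest release is followed.\<close>

definition replanning ::
  "('a::metric_space freeze_inst \<Rightarrow> 'a motion) \<Rightarrow> ('a \<Rightarrow> 'a \<Rightarrow> real \<Rightarrow> 'a) \<Rightarrow>
   'a freeze_inst \<Rightarrow> 'a motion" where
  "replanning S G \<sigma> i t =
     (let j = last_released \<sigma> t in if i \<le> j then plan S G \<sigma> j i t else pos \<sigma> i)"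

text \<open>The algorithm leaves open which optimal schedules and which shortest paths are used; this is
  the set of all its realizations.\<close>

definition replanning_algorithms :: "('a::metric_space freeze_inst \<Rightarrow> 'a motion) set" where
  "replanning_algorithms =
     {replanning S G | S G.
        (\<forall>\<sigma>. freeze_instance \<sigma> \<longrightarrow> optimal_schedule \<sigma> (S \<sigma>)) \<and> shortest_moves G}"

end

theory Submission
  imports Defs
begin

text \<open>At any time \<open>t\<close> every robot is within \<open>(sqrt 2 - 1) * t\<close> of its starting position: in phase (3) of a
  plan for optimum \<open>T\<close> the distance is at most \<open>t - sqrt 2 * T\<close> with \<open>t \<le> (1 + sqrt 2) * T\<close>, and at the
  end of this phase it is at most \<open>T = (sqrt 2 - 1) * (1 + sqrt 2) * T\<close>.  As \<open>rel \<sigma> j\<close> is a lower bound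
  for the optimum of the instance truncated after \<open>r\<^sub>j\<close>, all robots are home in time, and the last plan
  ends at \<open>(1 + sqrt 2) * OPT \<sigma>\<close>.

  Optimal schedules exist although the space need not be compact: a schedule matters only through its
  wake-up tree and its wake-up times.  There are finitely many trees, and the times for a fixed tree
  are subject to closed conditions, so that minimal times exist.  Conversely, tree and times are
  realised by moving along shortest paths.\<close>

subsection \<open>Gluing, geodesics and Lipschitz extensions\<close>

text \<open>Across \<open>b\<close> the triangle inequality through \<open>f b\<close> costs
  nothing, since distances on the line add up.\<close>

lemma lipschitz_on_glue:
  fixes f :: "real \<Rightarrow> 'a::metric_space"
  assumes "C-lipschitz_on (S \<inter> {..b}) f" "C-lipschitz_on (S \<inter> {b..}) f" "b \<in> S"
  shows "C-lipschitz_on S f"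
proof (rule lipschitz_on_leI)
  show "0 \<le> C" using assms(1) by (rule lipschitz_on_nonneg)
next
  fix x y assume xy: "x \<in> S" "y \<in> S" "x \<le> y"
  consider "y \<le> b" | "b \<le> x" | "x \<le> b" "b \<le> y" by linarith
  then show "dist (f x) (f y) \<le> C * dist x y"
  proof cases
    case 1
    then show ?thesis using xy by (intro lipschitz_onD[OF assms(1)]) auto
  next
    case 2
    then show ?thesis using xy by (intro lipschitz_onD[OF assms(2)]) auto
  next
    case 3
    have "dist (f x) (f y) \<le> dist (f x) (f b) + dist (f b) (f y)"
      by (rule dist_triangle)
    also have "\<dots> \<le> C * dist x b + C * dist b y"
      using xy 3 assms(3)
      by (intro add_mono lipschitz_onD[OF assms(1)] lipschitz_onD[OF assms(2)]) auto
    also have "\<dots> = C * dist x y"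
      using 3 by (simp add: dist_real_def algebra_simps)
    finally show ?thesis .
  qed
qed

lemma lipschitz_on_shift:
  fixes f :: "real \<Rightarrow> 'a::metric_space"
  assumes "C-lipschitz_on {0..} f"
  shows "C-lipschitz_on {a..} (\<lambda>t. f (t - a))"
proof (rule lipschitz_onI)
  fix x y assume "x \<in> {a..}" "y \<in> {a..}"
  then have "dist (f (x - a)) (f (y - a)) \<le> C * dist (x - a) (y - a)"
    by (intro lipschitz_onD[OF assms]) auto
  then show "dist (f (x - a)) (f (y - a)) \<le> C * dist x y"
    by (simp add: dist_real_def)
qed (rule lipschitz_on_nonneg[OF assms])

lemma shortest_movesD:
  assumes "shortest_moves G"
  shows "G x y 0 = x" "dist x y \<le> s \<Longrightarrow> G x y s = y" "1-lipschitz_on {0..} (G x y)"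
  using assms unfolding shortest_moves_def by blast+

lemma shortest_moves_const:
  assumes "shortest_moves G" "0 \<le> s"
  shows "G x x s = x"
  using shortest_movesD(2)[OF assms(1), of x x s] assms(2) by simp

text \<open>Compare with the arrival at time \<open>dist x y\<close>: the Lipschitz bound limits how
  far \<open>y\<close> can still be.\<close>

lemma shortest_moves_dist:
  assumes "shortest_moves G" "0 \<le> s"
  shows "dist (G x y s) y \<le> max 0 (dist x y - s)"
proof (cases "dist x y \<le> s")
  case True
  then show ?thesis using shortest_movesD(2)[OF assms(1) True] by simp
next
  case False
  have "dist (G x y s) (G x y (dist x y)) \<le> 1 * dist s (dist x y)"
    using assms(2) by (intro lipschitz_onD[OF shortest_movesD(3)[OF assms(1)]]) auto
  then show ?thesis
    using False shortest_movesD(2)[OF assms(1), of x y "dist x y"] by (simp add: dist_real_def)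
qed

text \<open>Along a shortest path the distance from the start is additive, so that distance is an arc
  length parameter, and a point at a given distance exists by the intermediate value theorem.\<close>

lemma geodesic_exists:
  fixes x y :: "'a::metric_space"
  assumes g: "path g" "pathstart g = x" "pathfinish g = y" "path_length g = ereal (dist x y)"
  shows "\<exists>f. f 0 = x \<and> (\<forall>s\<ge>dist x y. f s = y) \<and> 1-lipschitz_on {0..} f"
proof -
  have g0: "g 0 = x" and g1: "g 1 = y" using g by (auto simp: pathstart_def pathfinish_def)
  define h where "h u = dist x (g u)" for u
  have tri: "dist (g u) (g v) = h v - h u" if "0 \<le> u" "u \<le> v" "v \<le> 1" for u v
  proof -
    \<comment> \<open>This polygon is no longer than \<open>dist x y\<close>, which turns the
      triangle inequality at \<open>g u\<close> between \<open>x\<close> and \<open>g v\<close> into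
      an equality.\<close>
    let ?ts = "[0, u, v, 1::real]"
    have "ereal (\<Sum>k<length ?ts - 1. dist (g (?ts ! k)) (g (?ts ! Suc k))) \<le> path_length g"
      unfolding path_length_def using that by (intro SUP_upper) auto
    moreover have "(\<Sum>k<length ?ts - 1. dist (g (?ts ! k)) (g (?ts ! Suc k)))
        = dist x (g u) + dist (g u) (g v) + dist (g v) y"
      by (simp add: numeral_eq_Suc g0 g1)
    ultimately have "dist x (g u) + dist (g u) (g v) + dist (g v) y \<le> dist x y"
      using g(4) by simp
    then show ?thesis
      using dist_triangle[of x "g v" "g u"] dist_triangle[of x y "g v"]
      by (simp add: h_def)
  qed
  have iso: "dist (g u) (g v) = \<bar>h u - h v\<bar>" if "u \<in> {0..1}" "v \<in> {0..1}" for u v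
  proof (cases "u \<le> v")
    case True
    then show ?thesis using tri[of u v] that zero_le_dist[of "g u" "g v"] by simp
  next
    case False
    then show ?thesis using tri[of v u] that zero_le_dist[of "g u" "g v"]
      by (simp add: dist_commute)
  qed
  have cont: "continuous_on {0..1} h"
    using g(1) unfolding h_def path_def by (intro continuous_intros)
  have h01: "h 0 = 0" "h 1 = dist x y" by (auto simp: h_def g0 g1)
  have ex: "\<exists>u. u \<in> {0..1} \<and> h u = min (max s 0) (dist x y)" for s
    using IVT'[of h 0 "min (max s 0) (dist x y)" 1] cont h01 by auto
  \<comment> \<open>Clamping to \<open>[0, dist x y]\<close> is 1-Lipschitz and makes the motion
    wait at \<open>y\<close>. The choice of the parameter is harmless: by \<open>iso\<close>,
    parameters with equal \<open>h\<close> have the same image.\<close>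
  define p where "p s = (SOME u. u \<in> {0..1} \<and> h u = min (max s 0) (dist x y))" for s
  have p: "p s \<in> {0..1}" "h (p s) = min (max s 0) (dist x y)" for s
    using someI_ex[OF ex[of s]] unfolding p_def by auto
  show ?thesis
  proof (intro exI[of _ "g \<circ> p"] conjI allI impI)
    show "(g \<circ> p) 0 = x"
      using p(2)[of 0] by (simp add: h_def)
  next
    fix s assume "dist x y \<le> s"
    then have "h (p s) = dist x y"
      using p(2)[of s] zero_le_dist[of x y] by linarith
    then have "dist (g (p s)) (g 1) = 0"
      using iso[of "p s" 1] p(1)[of s] h01 by auto
    then show "(g \<circ> p) s = y" by (simp add: g1)
  next
    show "1-lipschitz_on {0..} (g \<circ> p)"
    proof (rule lipschitz_onI)
      fix s t :: real assume "s \<in> {0..}" "t \<in> {0..}"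
      then show "dist ((g \<circ> p) s) ((g \<circ> p) t) \<le> 1 * dist s t"
        using iso[OF p(1) p(1), of s t] p(2)[of s] p(2)[of t]
        by (auto simp: dist_real_def)
    qed simp
  qed
qed

lemma shortest_moves_exist:
  assumes "strongly_connected (UNIV :: 'a::metric_space set)"
  shows "\<exists>G :: 'a \<Rightarrow> 'a \<Rightarrow> real \<Rightarrow> 'a. shortest_moves G"
proof -
  have "\<exists>f. f 0 = x \<and> (\<forall>s\<ge>dist x y. f s = y) \<and> 1-lipschitz_on {0..} f" for x y :: 'a
    using assms geodesic_exists unfolding strongly_connected_def by blast
  then show ?thesis unfolding shortest_moves_def by metis
qed

text \<open>Times are added in increasing order. The last prescribed point is joined to the new one
  by a shortest move, which arrives in time because \<open>f\<close> is 1-Lipschitz on the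
  prescribed times.\<close>

lemma lipschitz_extension:
  fixes f :: "real \<Rightarrow> 'a::metric_space" and G :: "'a \<Rightarrow> 'a \<Rightarrow> real \<Rightarrow> 'a"
  assumes G: "shortest_moves G"
    and "finite A" "\<forall>t\<in>A. a < t" "1-lipschitz_on (insert a A) f"
  shows "\<exists>g. 1-lipschitz_on {a..} g \<and> (\<forall>t\<in>insert a A. g t = f t)"
  using assms(2-)
proof (induction A rule: finite_linorder_max_induct)
  case empty
  show ?case
    by (rule exI[of _ "\<lambda>_. f a"]) (auto intro!: lipschitz_onI)
next
  case (insert b A)
  have "1-lipschitz_on (insert a A) f"
    using insert.prems(2) by (rule lipschitz_on_subset) auto
  then obtain g where g: "1-lipschitz_on {a..} g" "\<And>t. t \<in> insert a A \<Longrightarrow> g t = f t"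
    using insert.IH insert.prems(1) by blast
  define m where "m = Max (insert a A)"
  have m: "m \<in> insert a A" unfolding m_def using insert(1) by (intro Max_in) auto
  have mmax: "t \<le> m" if "t \<in> insert a A" for t
    unfolding m_def using insert(1) that by (intro Max_ge) auto
  have mb: "m < b" using m insert by auto
  have am: "a \<le> m" using mmax by auto
  define g' where "g' t = (if t \<le> m then g t else G (f m) (f b) (t - m))" for t
  have g'm: "g' m = f m" using g(2)[OF m] by (simp add: g'_def)
  have "1-lipschitz_on {a..} g'"
  proof (rule lipschitz_on_glue[where b = m])
    have "1-lipschitz_on ({a..} \<inter> {..m}) g" using g(1) by (rule lipschitz_on_subset) auto
    then show "1-lipschitz_on ({a..} \<inter> {..m}) g'"
      by (rule lipschitz_on_transform) (auto simp: g'_def)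
    have "1-lipschitz_on ({a..} \<inter> {m..}) (\<lambda>t. G (f m) (f b) (t - m))"
      using lipschitz_on_shift[OF shortest_movesD(3)[OF G]] by (rule lipschitz_on_subset) auto
    then show "1-lipschitz_on ({a..} \<inter> {m..}) g'"
      using g(2)[OF m] shortest_movesD(1)[OF G]
      by (elim lipschitz_on_transform) (auto simp: g'_def)
  qed (use am in auto)
  moreover have "g' t = f t" if "t \<in> insert a A" for t
    using mmax[OF that] g(2)[OF that] by (simp add: g'_def)
  moreover have "g' b = f b"
  proof -
    have "dist (f m) (f b) \<le> 1 * dist m b"
      using m by (intro lipschitz_onD[OF insert.prems(2)]) auto
    then show ?thesis
      using mb shortest_movesD(2)[OF G, of "f m" "f b" "b - m"]
      by (simp add: g'_def dist_real_def)
  qed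
  ultimately show ?case by auto
qed

subsection \<open>Activation times\<close>

lemma active_mono: "active \<sigma> x i s \<Longrightarrow> s \<le> t \<Longrightarrow> active \<sigma> x i t"
  by (induction rule: active.induct) (auto intro: active.intros)

lemma active_nonneg: "active \<sigma> x i t \<Longrightarrow> 0 \<le> t"
  by (induction rule: active.induct) auto

lemma active_index: "active \<sigma> x i t \<Longrightarrow> i = 0 \<or> i < length \<sigma>"
  by (induction rule: active.induct) auto

lemma active_released: "active \<sigma> x i t \<Longrightarrow> i \<noteq> 0 \<Longrightarrow> rel \<sigma> i \<le> t"
  by (induction rule: active.induct) auto

text \<open>A real infimum, meaningful only for robots that are activated at some time; hence the
  premises \<open>active \<sigma> x i t\<close> in the lemmas below. In a schedule it is
  attained.\<close>

definition activation :: "'a freeze_inst \<Rightarrow> 'a motion \<Rightarrow> nat \<Rightarrow> real" where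
  "activation \<sigma> x i = Inf {t. active \<sigma> x i t}"

lemma activation_le: "active \<sigma> x i t \<Longrightarrow> activation \<sigma> x i \<le> t"
  unfolding activation_def by (intro cInf_lower bdd_belowI[of _ 0]) (auto dest: active_nonneg)

lemma active_after_activation:
  assumes "active \<sigma> x i t" "activation \<sigma> x i < s"
  shows "active \<sigma> x i s"
proof -
  obtain u where "active \<sigma> x i u" "u < s"
    using cInf_lessD[of "{t. active \<sigma> x i t}" s] assms unfolding activation_def by auto
  then show ?thesis by (auto intro: active_mono)
qed

lemma activation_nonneg: "active \<sigma> x i t \<Longrightarrow> 0 \<le> activation \<sigma> x i"
  unfolding activation_def by (intro cInf_greatest) (auto dest: active_nonneg)

text \<open>The chain of activations leading to \<open>i\<close> starts at robot \<open>0\<close>,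
  outside \<open>D\<close>, so some link of it enters \<open>D\<close>.\<close>

lemma active_entry:
  assumes "active \<sigma> x i t" "i \<in> D" "0 \<notin> D"
  shows "\<exists>j w s. j \<in> D \<and> w \<notin> D \<and> s \<le> t \<and> active \<sigma> x w s \<and> j < length \<sigma> \<and>
           rel \<sigma> j \<le> s \<and> x w s = pos \<sigma> j"
  using assms
proof (induction rule: active.induct)
  case (visited w s i t)
  show ?case
  proof (cases "w \<in> D")
    case True
    then show ?thesis using visited by (meson order.trans)
  next
    case False
    then show ?thesis using visited by blast
  qed
qed simp

lemma schedule_continuous:
  assumes "schedule \<sigma> x" "i < length \<sigma>"
  shows "continuous_on {0..} (x i)"
  using assms unfolding schedule_def by (auto intro: lipschitz_on_continuous_on)

text \<open>If the first activation time \<open>a\<close> of a robot were not attained, consider the set \<open>D\<close> of all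
  robots with this defect and this time \<open>a\<close>.  Arbitrarily shortly after \<open>a\<close> some robot outside \<open>D\<close>
  activates one in \<open>D\<close>, and by continuity it does so at time \<open>a\<close> already.\<close>

lemma active_activation:
  assumes sch: "schedule \<sigma> x" and ne: "\<sigma> \<noteq> []" and act: "active \<sigma> x i t0"
  shows "active \<sigma> x i (activation \<sigma> x i)"
proof (rule ccontr)
  assume na: "\<not> active \<sigma> x i (activation \<sigma> x i)"
  define a where "a = activation \<sigma> x i"
  define D where "D = {j. (\<exists>t. active \<sigma> x j t) \<and> activation \<sigma> x j = a \<and> \<not> active \<sigma> x j a}"
  have a0: "0 \<le> a" unfolding a_def using act by (rule activation_nonneg)
  have 0: "0 \<notin> D" using a0 by (auto simp: D_def intro: active.initial)
  have iD: "i \<in> D" using na act by (auto simp: D_def a_def)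
  define visit where "visit j w s \<longleftrightarrow> active \<sigma> x w s \<and> rel \<sigma> j \<le> s \<and> x w s = pos \<sigma> j" for j w s
  let ?n = "length \<sigma>"
  \<comment> \<open>If \<open>w\<close> is active at \<open>a\<close>, it cannot be visiting a
    released \<open>j\<close> then, as \<open>j\<close> would be active at \<open>a\<close>. So
    \<open>j\<close> is released later, or \<open>w\<close> is elsewhere and by continuity stays
    away for a while. If \<open>w\<close> is inactive at \<open>a\<close>, it becomes active
    strictly later or never.\<close>
  have ev: "\<forall>\<^sub>F s in at_right a. \<not> visit j w s" if j: "j \<in> D" "j < ?n" and w: "w \<notin> D" "w < ?n" for j w
  proof (cases "active \<sigma> x w a")
    case True
    have "\<not> (rel \<sigma> j \<le> a \<and> x w a = pos \<sigma> j)"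
      using True j active.visited[of \<sigma> x w a j a] by (auto simp: D_def)
    then consider "a < rel \<sigma> j" | "x w a \<noteq> pos \<sigma> j" by linarith
    then show ?thesis
    proof cases
      case 1
      then have "\<forall>\<^sub>F s in at_right a. s < rel \<sigma> j" by (rule eventually_at_right_real[THEN eventually_mono]) auto
      then show ?thesis by eventually_elim (auto simp: visit_def)
    next
      case 2
      have "(x w \<longlongrightarrow> x w a) (at a within {0..})"
        using schedule_continuous[OF sch w(2)] a0 by (simp add: continuous_on_def)
      then have "(x w \<longlongrightarrow> x w a) (at_right a)"
        by (rule tendsto_within_subset) (use a0 in auto)
      then have "\<forall>\<^sub>F s in at_right a. x w s \<noteq> pos \<sigma> j" using 2 by (rule tendsto_imp_eventually_ne)
      then show ?thesis by eventually_elim (auto simp: visit_def)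
    qed
  next
    case False
    show ?thesis
    proof (cases "\<exists>t. active \<sigma> x w t")
      case True
      \<comment> \<open>An earlier infimum would make \<open>w\<close> active at \<open>a\<close>,
        and an infimum equal to \<open>a\<close> would put \<open>w\<close> into
        \<open>D\<close>.\<close>
      then have "a < activation \<sigma> x w"
        using w(1) False active_after_activation[of \<sigma> x w _ a]
        by (force simp: D_def)
      then have "\<forall>\<^sub>F s in at_right a. s < activation \<sigma> x w"
        by (rule eventually_at_right_real[THEN eventually_mono]) auto
      then show ?thesis by eventually_elim (use activation_le in \<open>force simp: visit_def\<close>)
    qed (auto simp: visit_def)
  qed
  \<comment> \<open>There are finitely many pairs, so one right neighbourhood of \<open>a\<close>
    serves all of them.\<close>
  have "\<forall>\<^sub>F s in at_right a. \<forall>p\<in>(D \<inter> {..<?n}) \<times> ({..<?n} - D). \<not> visit (fst p) (snd p) s"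
    by (rule eventually_ball_finite) (auto intro: ev)
  then obtain b where b: "a < b"
    and nov: "\<And>s j w. a < s \<Longrightarrow> s < b \<Longrightarrow> j \<in> D \<Longrightarrow> j < ?n \<Longrightarrow> w \<notin> D \<Longrightarrow> w < ?n \<Longrightarrow> \<not> visit j w s"
    unfolding eventually_at_right_field by fastforce
  obtain t where t: "a < t" "t < b" using b dense by blast
  have "active \<sigma> x i t"
    using active_after_activation[OF act] t(1) by (simp add: a_def)
  then obtain j w s where jws: "j \<in> D" "w \<notin> D" "s \<le> t" "active \<sigma> x w s" "j < ?n" "rel \<sigma> j \<le> s"
    "x w s = pos \<sigma> j"
    using active_entry[OF _ iD 0] by blast
  have "active \<sigma> x j s" using jws by (auto intro: active.visited)
  then have "a \<le> s" "s \<noteq> a" using activation_le jws(1) by (auto simp: D_def)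
  moreover have "w < ?n" using active_index[OF jws(4)] ne by auto
  ultimately show False using nov[of s j w] jws t by (auto simp: visit_def)
qed

lemma active_iff_activation:
  assumes "schedule \<sigma> x" "\<sigma> \<noteq> []" "active \<sigma> x i t0"
  shows "active \<sigma> x i t \<longleftrightarrow> activation \<sigma> x i \<le> t"
  using active_activation[OF assms] active_mono activation_le by blast

text \<open>Before this time the robot is frozen, and the Lipschitz bound carries its position over
  to the end point. The end point matters because a robot's own wake-up is a stop of its
  itinerary.\<close>

lemma home_until_activation:
  assumes sch: "schedule \<sigma> x" and "i < length \<sigma>" "0 \<le> t" "t \<le> activation \<sigma> x i"
  shows "x i t = pos \<sigma> i"
proof (cases "t = 0")
  case True
  then show ?thesis using assms by (simp add: schedule_def)
next
  case False
  have "dist (x i t) (pos \<sigma> i) \<le> 0 + e" if e: "0 < e" for e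
  proof -
    define s where "s = max 0 (t - e)"
    have s: "0 \<le> s" "s < t" "t - s \<le> e" using e False assms by (auto simp: s_def)
    have "x i s = pos \<sigma> i"
      using s assms activation_le[of \<sigma> x i s] by (force simp: schedule_def)
    moreover have "dist (x i t) (x i s) \<le> 1 * dist t s"
      using s assms by (intro lipschitz_onD[of 1 "{0..}"]) (auto simp: schedule_def)
    ultimately show ?thesis using s by (simp add: dist_real_def)
  qed
  then have "dist (x i t) (pos \<sigma> i) \<le> 0" by (rule field_le_epsilon)
  then show ?thesis by simp
qed

text \<open>Among the robots not reached from \<open>r\<^sub>0\<close> by first wake-ups, take one of least activation time and
  look at the first entry into this set.\<close>

lemma first_wake_reachable:
  assumes sch: "schedule \<sigma> x" and ne: "\<sigma> \<noteq> []" and act: "\<And>i. i < length \<sigma> \<Longrightarrow> active \<sigma> x i T"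
    and E: "E = {(w, i). w < length \<sigma> \<and> i < length \<sigma> \<and> active \<sigma> x w (activation \<sigma> x i) \<and>
               rel \<sigma> i \<le> activation \<sigma> x i \<and> x w (activation \<sigma> x i) = pos \<sigma> i}"
    and i: "i < length \<sigma>"
  shows "(0, i) \<in> E\<^sup>*"
proof (rule ccontr)
  assume ni: "(0, i) \<notin> E\<^sup>*"
  define D where "D = {j. j < length \<sigma> \<and> (0, j) \<notin> E\<^sup>*}"
  have "finite D" "D \<noteq> {}" using i ni by (auto simp: D_def)
  then obtain k where k: "k \<in> D" and kmin: "\<And>j. j \<in> D \<Longrightarrow> activation \<sigma> x k \<le> activation \<sigma> x j"
    using arg_min_if_finite(1) arg_min_least by metis
  have "active \<sigma> x k (activation \<sigma> x k)"
    using active_activation[OF sch ne act] k by (auto simp: D_def)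
  then obtain j w s where jws: "j \<in> D" "w \<notin> D" "s \<le> activation \<sigma> x k" "active \<sigma> x w s"
    "j < length \<sigma>" "rel \<sigma> j \<le> s" "x w s = pos \<sigma> j"
    using active_entry[OF _ k, of \<sigma> x "activation \<sigma> x k"] by (auto simp: D_def)
  have "active \<sigma> x j s" using jws by (auto intro: active.visited)
  \<comment> \<open>Minimality of \<open>k\<close> forces this entry to be the first activation of
    \<open>j\<close>, so that \<open>(w, j)\<close> is an edge of \<open>E\<close>.\<close>
  then have s: "s = activation \<sigma> x j"
    using activation_le kmin[OF jws(1)] jws(3) by (meson order.antisym order.trans)
  have w: "w < length \<sigma>" using active_index[OF jws(4)] ne by auto
  then have "(w, j) \<in> E" using jws s by (auto simp: E)
  moreover have "(0, w) \<in> E\<^sup>*" using w jws(2) by (auto simp: D_def)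
  ultimately show False using jws(1) by (auto simp: D_def intro: rtrancl_into_rtrancl)
qed

subsection \<open>Wake-up trees and optimal schedules\<close>

text \<open>The combinatorial content of a schedule: \<open>w i\<close> is the robot waking \<open>r\<^sub>i\<close> and \<open>s i\<close> the time
  of this event; \<open>wake_tree\<close> states that \<open>w\<close> is acyclic with root \<open>0\<close>.\<close>

definition wake_tree :: "nat \<Rightarrow> (nat \<Rightarrow> nat) \<Rightarrow> bool" where
  "wake_tree n w \<longleftrightarrow> (\<exists>r :: nat \<Rightarrow> nat. \<forall>i. 0 < i \<and> i < n \<longrightarrow> w i < n \<and> r (w i) < r i)"

definition itinerary :: "nat \<Rightarrow> (nat \<Rightarrow> nat) \<Rightarrow> nat \<Rightarrow> nat set" where
  "itinerary n w k = insert k {i. 0 < i \<and> i < n \<and> w i = k}"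

text \<open>The pairwise condition says that each robot can make its stops at the given times with
  speed at most 1; the absolute value avoids fixing their order. For a fixed tree all conditions on
  \<open>s\<close> are closed. Acyclicity is kept apart from the times, since robots at a common
  position may be woken simultaneously.\<close>

definition feasible :: "'a::metric_space freeze_inst \<Rightarrow> (nat \<Rightarrow> nat) \<Rightarrow> (nat \<Rightarrow> real) \<Rightarrow> bool" where
  "feasible \<sigma> w s \<longleftrightarrow> wake_tree (length \<sigma>) w \<and> s 0 = 0 \<and>
     (\<forall>i. 0 < i \<and> i < length \<sigma> \<longrightarrow> rel \<sigma> i \<le> s i \<and> s (w i) \<le> s i) \<and>
     (\<forall>k<length \<sigma>. \<forall>i\<in>itinerary (length \<sigma>) w k. \<forall>j\<in>itinerary (length \<sigma>) w k.
        dist (pos \<sigma> i) (pos \<sigma> j) \<le> \<bar>s i - s j\<bar>)"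

section \<open>Correspondence between schedules and feasible wake-up times\<close>

lemma wake_tree_induct [consumes 2, case_names root step]:
  assumes "wake_tree n w" "i < n"
    and "P 0" "\<And>i. 0 < i \<Longrightarrow> i < n \<Longrightarrow> w i < n \<Longrightarrow> P (w i) \<Longrightarrow> P i"
  shows "P i"
proof -
  obtain r :: "nat \<Rightarrow> nat" where r: "\<And>i. 0 < i \<Longrightarrow> i < n \<Longrightarrow> w i < n \<and> r (w i) < r i"
    using assms(1) unfolding wake_tree_def by blast
  show ?thesis using assms(2)
  proof (induction "r i" arbitrary: i rule: less_induct)
    case less
    then show ?case using assms(3,4) r[of i] by (cases "i = 0") auto
  qed
qed

text \<open>The times are the first activations, and the wakers are predecessors on shortest chains
  of first wake-ups starting at robot \<open>0\<close>.\<close>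

lemma feasible_of_schedule:
  assumes sch: "schedule \<sigma> x" and ne: "\<sigma> \<noteq> []" and act: "\<And>i. i < length \<sigma> \<Longrightarrow> active \<sigma> x i T"
  shows "\<exists>w s. feasible \<sigma> w s \<and> (\<forall>i<length \<sigma>. s i \<le> T)"
proof -
  let ?n = "length \<sigma>"
  define s where "s = activation \<sigma> x"
  define E where "E = {(w, i). w < ?n \<and> i < ?n \<and> active \<sigma> x w (s i) \<and> rel \<sigma> i \<le> s i \<and>
    x w (s i) = pos \<sigma> i}"
  have reach: "\<exists>m. (0, i) \<in> E ^^ m" if "i < ?n" for i
    using first_wake_reachable[OF sch ne act _ that, of E] rtrancl_imp_relpow
    unfolding E_def s_def by blast
  \<comment> \<open>The graph distance from \<open>0\<close> serves as rank: the predecessor on a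
    shortest chain is strictly closer, even when wake-up times coincide.\<close>
  define r where "r i = (LEAST m. (0, i) \<in> E ^^ m)" for i
  have "\<exists>w. (w, i) \<in> E \<and> r w < r i" if i: "0 < i" "i < ?n" for i
  proof -
    have "(0, i) \<in> E ^^ r i" unfolding r_def using reach[OF i(2)] by (rule LeastI_ex)
    then obtain m where m: "r i = Suc m" using i by (cases "r i") auto
    then obtain w where w: "(0, w) \<in> E ^^ m" "(w, i) \<in> E"
      using \<open>(0, i) \<in> E ^^ r i\<close> by (auto elim: relpow_Suc_E)
    have "r w \<le> m" unfolding r_def using w(1) by (rule Least_le)
    then show ?thesis using w m by auto
  qed
  then obtain w where w: "\<And>i. 0 < i \<Longrightarrow> i < ?n \<Longrightarrow> (w i, i) \<in> E \<and> r (w i) < r i" by metis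
  have s0: "0 \<le> s i" if "i < ?n" for i
    unfolding s_def using act[OF that] by (rule activation_nonneg)
  have at: "x k (s i) = pos \<sigma> i" if "k < ?n" "i \<in> itinerary ?n w k" for i k
  proof (cases "i = k")
    case True
    then show ?thesis using home_until_activation[OF sch that(1)] s0[OF that(1)] by (simp add: s_def)
  next
    case False
    then show ?thesis using that w[of i] by (auto simp: itinerary_def E_def)
  qed
  have "feasible \<sigma> w s"
    unfolding feasible_def
  proof (intro conjI allI impI ballI)
    show "wake_tree ?n w" unfolding wake_tree_def using w by (auto simp: E_def)
    have "s 0 \<le> 0" unfolding s_def by (rule activation_le) (rule active.initial, simp)
    then show "s 0 = 0" using s0[of 0] ne by simp
  next
    fix i assume i: "0 < i \<and> i < ?n"
    then show "rel \<sigma> i \<le> s i" using w[of i] by (auto simp: E_def)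
    have "active \<sigma> x (w i) (s i)" using w[of i] i by (auto simp: E_def)
    then show "s (w i) \<le> s i" unfolding s_def by (rule activation_le)
  next
    fix k i j assume k: "k < ?n" and ij: "i \<in> itinerary ?n w k" "j \<in> itinerary ?n w k"
    then have "i < ?n" "j < ?n" by (auto simp: itinerary_def)
    then have "dist (x k (s i)) (x k (s j)) \<le> 1 * dist (s i) (s j)"
      using sch k s0 by (intro lipschitz_onD[of 1 "{0..}"]) (auto simp: schedule_def)
    then show "dist (pos \<sigma> i) (pos \<sigma> j) \<le> \<bar>s i - s j\<bar>"
      using at[OF k ij(1)] at[OF k ij(2)] by (simp add: dist_real_def)
  qed
  moreover have "\<forall>i<?n. s i \<le> T" using act by (auto simp: s_def intro: activation_le)
  ultimately show ?thesis by blast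
qed

lemma feasible_nonneg:
  assumes "feasible \<sigma> w s" "i < length \<sigma>"
  shows "0 \<le> s i"
proof -
  have "wake_tree (length \<sigma>) w" using assms(1) by (simp add: feasible_def)
  then show ?thesis using assms(2)
  proof (induction rule: wake_tree_induct)
    case (step i)
    then have "s (w i) \<le> s i" using assms(1) by (simp add: feasible_def)
    then show ?case using step by simp
  qed (use assms(1) in \<open>simp add: feasible_def\<close>)
qed

text \<open>Robot \<open>k\<close> waits at home until \<open>s k\<close> and then follows a
  Lipschitz extension of its finitely many prescribed stops.\<close>

lemma schedule_of_feasible:
  fixes \<sigma> :: "'a::metric_space freeze_inst"
  assumes G: "shortest_moves (G :: 'a \<Rightarrow> 'a \<Rightarrow> real \<Rightarrow> 'a)" and f: "feasible \<sigma> w s"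
  shows "\<exists>x. schedule \<sigma> x \<and> (\<forall>i<length \<sigma>. active \<sigma> x i (s i))"
proof -
  let ?n = "length \<sigma>"
  have tree: "wake_tree ?n w" using f by (simp add: feasible_def)
  have ex: "\<exists>g. 1-lipschitz_on {0..} g \<and> (\<forall>t\<in>{0..s k}. g t = pos \<sigma> k) \<and>
      (\<forall>i\<in>itinerary ?n w k. g (s i) = pos \<sigma> i)" if k: "k < ?n" for k
  proof -
    let ?C = "itinerary ?n w k"
    have sk: "0 \<le> s k" using feasible_nonneg[OF f k] .
    have kC: "k \<in> ?C" by (simp add: itinerary_def)
    have fin: "finite ?C" by (simp add: itinerary_def)
    have le: "s k \<le> s i" if "i \<in> ?C" for i using f that by (auto simp: feasible_def itinerary_def)
    have dist: "dist (pos \<sigma> i) (pos \<sigma> j) \<le> \<bar>s i - s j\<bar>" if "i \<in> ?C" "j \<in> ?C" for i j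
      using f k that by (simp add: feasible_def)
    \<comment> \<open>The stops as a function of time. It does not depend on the choice made by
      \<open>inv_into\<close>, because stops with equal times are at distance 0.\<close>
    define h where "h = pos \<sigma> \<circ> inv_into ?C s"
    have h: "h (s i) = pos \<sigma> i" if "i \<in> ?C" for i
      using dist[OF inv_into_into[of "s i" s ?C] that] f_inv_into_f[of "s i" s ?C] that
      by (simp add: h_def)
    have lip: "1-lipschitz_on (s ` ?C) h"
      by (rule lipschitz_onI) (auto simp: h dist dist_real_def)
    have ins: "insert (s k) (s ` ?C - {s k}) = s ` ?C" using kC by auto
    have "\<forall>t\<in>s ` ?C - {s k}. s k < t" using le by force
    from lipschitz_extension[OF G _ this, of h, unfolded ins, OF _ lip] fin
    obtain g where g: "1-lipschitz_on {s k..} g" "\<forall>t\<in>s ` ?C. g t = h t" by auto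
    have gC: "g (s i) = pos \<sigma> i" if "i \<in> ?C" for i using h[OF that] g(2) that by auto
    define g' where "g' t = (if t \<le> s k then pos \<sigma> k else g t)" for t
    have "1-lipschitz_on {0..} g'"
    proof (rule lipschitz_on_glue[where b = "s k"])
      show "1-lipschitz_on ({0..} \<inter> {..s k}) g'" by (rule lipschitz_onI) (auto simp: g'_def)
      have "1-lipschitz_on ({0..} \<inter> {s k..}) g" using g(1) by (rule lipschitz_on_subset) auto
      then show "1-lipschitz_on ({0..} \<inter> {s k..}) g'"
        by (rule lipschitz_on_transform) (auto simp: g'_def gC[OF kC])
    qed (use sk in auto)
    moreover have "g' (s i) = pos \<sigma> i" if "i \<in> ?C" for i
      using le[OF that] gC[OF that] gC[OF kC] by (cases "s i = s k") (auto simp: g'_def)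
    ultimately show ?thesis by (intro exI[of _ g']) (auto simp: g'_def)
  qed
  have "\<exists>x. \<forall>k<?n. 1-lipschitz_on {0..} (x k) \<and> (\<forall>t\<in>{0..s k}. x k t = pos \<sigma> k) \<and>
      (\<forall>i\<in>itinerary ?n w k. x k (s i) = pos \<sigma> i)"
    using ex by metis
  then obtain x where x: "\<forall>k<?n. 1-lipschitz_on {0..} (x k) \<and>
      (\<forall>t\<in>{0..s k}. x k t = pos \<sigma> k) \<and> (\<forall>i\<in>itinerary ?n w k. x k (s i) = pos \<sigma> i)" ..
  have xl: "1-lipschitz_on {0..} (x k)" if "k < ?n" for k using x that by blast
  have xh: "x k t = pos \<sigma> k" if "k < ?n" "0 \<le> t" "t \<le> s k" for k t using x that by auto
  have xs: "x k (s i) = pos \<sigma> i" if "k < ?n" "i \<in> itinerary ?n w k" for k i using x that by blast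
  \<comment> \<open>Activity spreads along the tree from the root: the waker is active by
    \<open>s (w i) \<le> s i\<close> and stands at \<open>pos \<sigma> i\<close> at time
    \<open>s i\<close>.\<close>
  have act: "active \<sigma> x i (s i)" if "i < ?n" for i
    using tree that
  proof (induction rule: wake_tree_induct)
    case root
    show ?case using f by (auto simp: feasible_def intro: active.initial)
  next
    case (step i)
    have "s (w i) \<le> s i" "rel \<sigma> i \<le> s i" using f step by (auto simp: feasible_def)
    then show ?case
      using step active_mono[of \<sigma> x "w i" "s (w i)" "s i"] xs[of "w i" i]
      by (auto intro!: active.visited[of \<sigma> x "w i" "s i" i] simp: itinerary_def)
  qed
  have "schedule \<sigma> x"
    unfolding schedule_def
  proof (intro allI impI conjI)
    fix i t assume i: "i < ?n" and t: "t \<ge> 0" and na: "\<not> active \<sigma> x i t"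
    have "t \<le> s i" using active_mono[OF act[OF i], of t] na by linarith
    then show "x i t = pos \<sigma> i" using xh i t by auto
  qed (use xl xh feasible_nonneg[OF f] in auto)
  then show ?thesis using act by blast
qed

section \<open>Compactness and existence of optimal schedules\<close>

lemma pointwise_convergent_subsequence:
  fixes f :: "nat \<Rightarrow> nat \<Rightarrow> real"
  assumes "\<And>i. i < n \<Longrightarrow> bounded (range (\<lambda>m. f m i))"
  shows "\<exists>r l. strict_mono (r :: nat \<Rightarrow> nat) \<and> (\<forall>i<n. (\<lambda>m. f (r m) i) \<longlonglongrightarrow> l i)"
  using assms
proof (induction n)
  case 0
  show ?case by (intro exI[of _ id]) (auto simp: strict_mono_def)
next
  case (Suc n)
  then obtain r l where r: "strict_mono r" "\<And>i. i < n \<Longrightarrow> (\<lambda>m. f (r m) i) \<longlonglongrightarrow> l i" by force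
  have "bounded (range (\<lambda>m. f (r m) n))"
    using Suc.prems[of n] by (rule bounded_subset) auto
  \<comment> \<open>Bolzano-Weierstrass for coordinate \<open>n\<close>, along the subsequence
    already found; refining it further keeps the other limits.\<close>
  then obtain a q where q: "strict_mono q" "((\<lambda>m. f (r m) n) \<circ> q) \<longlonglongrightarrow> a"
    using bounded_imp_convergent_subsequence by blast
  have "(\<lambda>m. f ((r \<circ> q) m) i) \<longlonglongrightarrow> (l(n := a)) i" if "i < Suc n" for i
  proof (cases "i = n")
    case True
    then show ?thesis using q(2) by (simp add: o_def)
  next
    case False
    then show ?thesis
      using LIMSEQ_subseq_LIMSEQ[OF r(2)[of i] q(1)] that by (simp add: o_def)
  qed
  then show ?case using strict_mono_o[OF r(1) q(1)] by blast
qed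

text \<open>Robot \<open>0\<close> wakes everybody alone: it starts after the last release
  \<open>R\<close> and allows the diameter \<open>D\<close> for each leg.\<close>

lemma feasible_exists:
  assumes "freeze_instance \<sigma>"
  shows "\<exists>w s. feasible \<sigma> w s"
proof -
  let ?n = "length \<sigma>"
  define D where "D = Max ((\<lambda>(i, j). dist (pos \<sigma> i) (pos \<sigma> j)) ` ({..<?n} \<times> {..<?n}))"
  define R where "R = Max (insert 0 (rel \<sigma> ` {..<?n}))"
  have D: "dist (pos \<sigma> i) (pos \<sigma> j) \<le> D" if "i < ?n" "j < ?n" for i j
    unfolding D_def using that by (intro Max_ge) force+
  have R: "rel \<sigma> i \<le> R" if "i < ?n" for i
    unfolding R_def using that by (intro Max_ge) auto
  have R0: "0 \<le> R" unfolding R_def by (intro Max_ge) auto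
  have n: "0 < ?n" using assms by (auto simp: freeze_instance_def)
  have D0: "0 \<le> D" using D[OF n n] by simp
  define s where "s i = (if i = 0 then 0 else R + real i * D)" for i :: nat
  have gap: "D \<le> s j - s i" if "i < j" for i j
  proof -
    have "1 * D \<le> (real j - real i) * D" using that D0 by (intro mult_right_mono) auto
    then show ?thesis using that R0 by (auto simp: s_def algebra_simps)
  qed
  have lip: "dist (pos \<sigma> i) (pos \<sigma> j) \<le> \<bar>s i - s j\<bar>" if "i < ?n" "j < ?n" for i j
    using gap[of i j] gap[of j i] D[OF that] by (cases i j rule: linorder_cases) auto
  have "wake_tree ?n (\<lambda>_. 0)"
    unfolding wake_tree_def using n by (intro exI[of _ "\<lambda>i. i"]) auto
  moreover have "rel \<sigma> i \<le> s i" "0 \<le> s i" if "0 < i" "i < ?n" for i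
  proof -
    have "0 \<le> real i * D" using D0 by simp
    then show "rel \<sigma> i \<le> s i" "0 \<le> s i" using R[OF that(2)] R0 that(1) by (auto simp: s_def)
  qed
  moreover have "s 0 = 0" by (simp add: s_def)
  moreover have "i < ?n" if "i \<in> itinerary ?n (\<lambda>_. 0) k" "k < ?n" for i k
    using that by (auto simp: itinerary_def)
  ultimately have "feasible \<sigma> (\<lambda>_. 0) s"
    using lip by (simp add: feasible_def)
  then show ?thesis by blast
qed

text \<open>With the tree fixed, the conditions are equations and non-strict inequalities between
  continuous functions of the times, so they pass to the limit.\<close>

lemma feasible_limit:
  assumes ne: "\<sigma> \<noteq> []" and f: "\<And>m. feasible \<sigma> w (f m)"
    and l: "\<And>i. i < length \<sigma> \<Longrightarrow> (\<lambda>m. f m i) \<longlonglongrightarrow> l i"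
  shows "feasible \<sigma> w l"
  unfolding feasible_def
proof (intro conjI allI impI ballI)
  have tree: "wake_tree (length \<sigma>) w" using f[of 0] by (simp add: feasible_def)
  then show "wake_tree (length \<sigma>) w" .
  have "(\<lambda>m. f m 0) \<longlonglongrightarrow> l 0" using l ne by auto
  moreover have "f m 0 = 0" for m using f[of m] by (simp add: feasible_def)
  ultimately show "l 0 = 0" by (simp add: LIMSEQ_const_iff)
  fix i assume i: "0 < i \<and> i < length \<sigma>"
  show "rel \<sigma> i \<le> l i"
    by (rule LIMSEQ_le_const[OF l]) (use i f in \<open>auto simp: feasible_def\<close>)
  have "w i < length \<sigma>" using tree i by (auto simp: wake_tree_def)
  then show "l (w i) \<le> l i"
    by (rule LIMSEQ_le[OF l l]) (use i f in \<open>auto simp: feasible_def\<close>)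
next
  fix k i j assume k: "k < length \<sigma>"
    and ij: "i \<in> itinerary (length \<sigma>) w k" "j \<in> itinerary (length \<sigma>) w k"
  then have "i < length \<sigma>" "j < length \<sigma>" by (auto simp: itinerary_def)
  then have "(\<lambda>m. \<bar>f m i - f m j\<bar>) \<longlonglongrightarrow> \<bar>l i - l j\<bar>"
    by (intro tendsto_intros l)
  then show "dist (pos \<sigma> i) (pos \<sigma> j) \<le> \<bar>l i - l j\<bar>"
    by (rule LIMSEQ_le_const) (use f k ij in \<open>auto simp: feasible_def\<close>)
qed

text \<open>Values of the waker function outside \<open>{1..<n}\<close> are irrelevant, so that only finitely many
  wake-up trees have to be considered.\<close>

lemma feasible_normalise:
  assumes "feasible \<sigma> w s"
  shows "feasible \<sigma> (\<lambda>i. if 0 < i \<and> i < length \<sigma> then w i else 0) s"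
proof -
  let ?w = "\<lambda>i. if 0 < i \<and> i < length \<sigma> then w i else 0"
  have "itinerary (length \<sigma>) ?w k = itinerary (length \<sigma>) w k" for k
    by (auto simp: itinerary_def)
  moreover have "wake_tree (length \<sigma>) ?w"
    using assms by (auto simp: feasible_def wake_tree_def)
  ultimately show ?thesis using assms by (simp add: feasible_def)
qed

text \<open>A minimising sequence uses one tree infinitely often, and along that tree the bounded
  times have a convergent subsequence whose limit is again feasible.\<close>

lemma minimal_makespan:
  assumes ne: "\<sigma> \<noteq> []" and ex: "feasible \<sigma> w0 s0"
  shows "\<exists>w s T. feasible \<sigma> w s \<and> (\<forall>i<length \<sigma>. s i \<le> T) \<and>
    (\<forall>w' s' T'. feasible \<sigma> w' s' \<and> (\<forall>i<length \<sigma>. s' i \<le> T') \<longrightarrow> T \<le> T')"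
proof -
  let ?n = "length \<sigma>"
  define M where "M = {T. \<exists>w s. feasible \<sigma> w s \<and> (\<forall>i<?n. s i \<le> T)}"
  have low: "0 \<le> T" if "T \<in> M" for T
    using that ne feasible_nonneg by (fastforce simp: M_def)
  have "Max (s0 ` {..<?n}) \<in> M"
    unfolding M_def using ex by (auto intro!: Max_ge)
  then have Mne: "M \<noteq> {}" by blast
  have bdd: "bdd_below M" using low by (rule bdd_belowI)
  define T where "T = Inf M"
  have Tle: "T \<le> T'" if "T' \<in> M" for T' unfolding T_def using that bdd by (rule cInf_lower)
  define W where "W = {w. \<forall>i. (i \<in> {..<?n} \<longrightarrow> w i \<in> {..<?n}) \<and> (i \<notin> {..<?n} \<longrightarrow> w i = (0::nat))}"
  have finW: "finite W" unfolding W_def by (rule finite_set_of_finite_funs) auto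
  have "\<exists>w s. w \<in> W \<and> feasible \<sigma> w s \<and> (\<forall>i<?n. s i \<le> T + inverse (real (Suc m)))" for m
  proof -
    have "T < T + inverse (real (Suc m))" by simp
    then obtain T' where "T' \<in> M" "T' < T + inverse (real (Suc m))"
      using cInf_lessD[OF Mne] unfolding T_def by blast
    then obtain w s where ws: "feasible \<sigma> w s" "\<forall>i<?n. s i \<le> T + inverse (real (Suc m))"
      unfolding M_def by fastforce
    have "(\<lambda>i. if 0 < i \<and> i < ?n then w i else 0) \<in> W"
      using ws(1) ne by (auto simp: W_def feasible_def wake_tree_def)
    then show ?thesis using feasible_normalise[OF ws(1)] ws(2) by blast
  qed
  then obtain w f where w: "\<And>m. w m \<in> W" and feas: "\<And>m. feasible \<sigma> (w m) (f m)"
    and f: "\<And>m i. i < ?n \<Longrightarrow> f m i \<le> T + inverse (real (Suc m))"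
    by metis
  have "finite (range w)" using w finW by (meson finite_subset image_subsetI)
  \<comment> \<open>Pigeonhole over the finitely many trees in \<open>W\<close>.\<close>
  then obtain m0 where "infinite {m. w m = w m0}"
    using pigeonhole_infinite[of UNIV w] by auto
  then obtain q :: "nat \<Rightarrow> nat" where q: "strict_mono q" "\<And>m. w (q m) = w m0"
    using infinite_enumerate by blast
  have "bounded (range (\<lambda>m. f (q m) i))" if i: "i < ?n" for i
  proof -
    have "f (q m) i \<in> {0..T + 1}" for m
      using feasible_nonneg[OF feas i, of "q m"] f[OF i, of "q m"] inverse_le_1_iff[of "real (Suc (q m))"]
      by auto
    then show ?thesis by (intro bounded_subset[OF bounded_closed_interval]) blast
  qed
  then obtain p l where p: "strict_mono p" "\<And>i. i < ?n \<Longrightarrow> (\<lambda>m. f (q (p m)) i) \<longlonglongrightarrow> l i"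
    using pointwise_convergent_subsequence[of ?n "\<lambda>m. f (q m)"] by blast
  have "feasible \<sigma> (w m0) l"
    using feas q(2) by (intro feasible_limit[OF ne _ p(2)]) metis
  moreover have "l i \<le> T" if i: "i < ?n" for i
  proof -
    have "strict_mono (q \<circ> p)" using q(1) p(1) by (rule strict_mono_o)
    from LIMSEQ_subseq_LIMSEQ[OF LIMSEQ_inverse_real_of_nat this]
    have "(\<lambda>m. T + inverse (real (Suc (q (p m))))) \<longlonglongrightarrow> T + 0"
      by (intro tendsto_intros) (simp add: o_def)
    then have "l i \<le> T + 0" by (rule LIMSEQ_le[OF p(2)[OF i]]) (use f[OF i] in auto)
    then show ?thesis by simp
  qed
  ultimately show ?thesis using Tle unfolding M_def by blast
qed

lemma completion_time_le:
  assumes "\<sigma> \<noteq> []" "\<And>i. i < length \<sigma> \<Longrightarrow> active \<sigma> x i T"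
  shows "completion_time \<sigma> x \<le> ereal T"
  unfolding completion_time_def
  using assms active_nonneg[of \<sigma> x 0 T] by (intro INF_lower) auto

text \<open>Any time by which a schedule has everybody active bounds the makespan of some feasible
  data, so the minimal makespan is a lower bound for \<open>OPT \<sigma>\<close>. Moving along
  \<open>G\<close> realises it.\<close>

lemma optimal_schedule_exists:
  fixes \<sigma> :: "'a::metric_space freeze_inst"
  assumes G: "shortest_moves (G :: 'a \<Rightarrow> 'a \<Rightarrow> real \<Rightarrow> 'a)" and inst: "freeze_instance \<sigma>"
  shows "\<exists>x T. optimal_schedule \<sigma> x \<and> OPT \<sigma> = ereal T"
proof -
  have ne: "\<sigma> \<noteq> []" using inst by (simp add: freeze_instance_def)
  obtain w s T where ws: "feasible \<sigma> w s" "\<And>i. i < length \<sigma> \<Longrightarrow> s i \<le> T"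
    and opt: "\<And>w' s' T'. feasible \<sigma> w' s' \<Longrightarrow> (\<And>i. i < length \<sigma> \<Longrightarrow> s' i \<le> T') \<Longrightarrow> T \<le> T'"
    using minimal_makespan[OF ne] feasible_exists[OF inst] by metis
  obtain x where x: "schedule \<sigma> x" "\<And>i. i < length \<sigma> \<Longrightarrow> active \<sigma> x i (s i)"
    using schedule_of_feasible[OF G ws(1)] by blast
  have up: "completion_time \<sigma> x \<le> ereal T"
    using completion_time_le[OF ne] active_mono[OF x(2) ws(2)] by blast
  have low: "ereal T \<le> completion_time \<sigma> y" if y: "schedule \<sigma> y" for y
    unfolding completion_time_def
  proof (rule INF_greatest)
    fix T' assume "T' \<in> {T. 0 \<le> T \<and> (\<forall>i<length \<sigma>. active \<sigma> y i T)}"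
    then obtain w' s' where "feasible \<sigma> w' s'" "\<forall>i<length \<sigma>. s' i \<le> T'"
      using feasible_of_schedule[OF y ne] by blast
    then show "ereal T \<le> ereal T'" using opt by simp
  qed
  have "OPT \<sigma> = ereal T"
    unfolding OPT_def using x(1) up low
    by (intro antisym INF_greatest INF_lower2[of x]) auto
  moreover have "completion_time \<sigma> x = ereal T" using up low[OF x(1)] by (rule antisym)
  ultimately show ?thesis using x(1) unfolding optimal_schedule_def by auto
qed

text \<open>As \<open>completion_time\<close> is an infimum, it yields activity only at times beyond
  \<open>T\<close>; activity at \<open>T\<close> itself follows because first activations are
  attained.\<close>

lemma optimal_schedule_attained:
  assumes opt: "optimal_schedule \<sigma> x" and ne: "\<sigma> \<noteq> []" and T: "OPT \<sigma> = ereal T" and i: "i < length \<sigma>"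
  shows "active \<sigma> x i T"
proof -
  have sch: "schedule \<sigma> x" and ct: "completion_time \<sigma> x = ereal T"
    using opt T by (auto simp: optimal_schedule_def)
  have act: "\<exists>t<T'. active \<sigma> x i t" if "T < T'" for T'
  proof -
    have "completion_time \<sigma> x < ereal T'" using ct that by simp
    then show ?thesis unfolding completion_time_def INF_less_iff using i by auto
  qed
  then obtain t0 where t0: "active \<sigma> x i t0" using gt_ex by blast
  have "activation \<sigma> x i \<le> T"
    using act activation_le by (meson dense_le_bounded gt_ex leI le_less_trans less_irrefl)
  then show ?thesis using active_iff_activation[OF sch ne t0] by blast
qed

subsection \<open>The replanning algorithm\<close>

lemma rel_mono:
  assumes "freeze_instance \<sigma>" "i \<le> j" "j < length \<sigma>"
  shows "rel \<sigma> i \<le> rel \<sigma> j"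
  using sorted_nth_mono[of "map snd \<sigma>" i j] assms by (simp add: freeze_instance_def)

lemma rel_nonneg:
  assumes "freeze_instance \<sigma>" "j < length \<sigma>"
  shows "0 \<le> rel \<sigma> j"
  using rel_mono[OF assms(1) _ assms(2), of 0] assms(1) by (simp add: freeze_instance_def)

lemma freeze_instance_take: "freeze_instance \<sigma> \<Longrightarrow> freeze_instance (take (Suc j) \<sigma>)"
  using sorted_wrt_take[of "(\<le>)" "map snd \<sigma>" "Suc j"]
  by (simp add: freeze_instance_def take_map)

lemma last_released:
  assumes "freeze_instance \<sigma>" "0 \<le> t"
  shows "last_released \<sigma> t < length \<sigma>" "rel \<sigma> (last_released \<sigma> t) \<le> t"
    "j < length \<sigma> \<Longrightarrow> rel \<sigma> j \<le> t \<Longrightarrow> j \<le> last_released \<sigma> t"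
proof -
  let ?J = "{j. j < length \<sigma> \<and> rel \<sigma> j \<le> t}"
  have "0 \<in> ?J" using assms by (auto simp: freeze_instance_def)
  then have "last_released \<sigma> t \<in> ?J" unfolding last_released_def by (intro Max_in) auto
  then show "last_released \<sigma> t < length \<sigma>" "rel \<sigma> (last_released \<sigma> t) \<le> t" by auto
  show "j < length \<sigma> \<Longrightarrow> rel \<sigma> j \<le> t \<Longrightarrow> j \<le> last_released \<sigma> t"
    unfolding last_released_def by (intro Max_ge) auto
qed

lemma last_released_interval:
  assumes "freeze_instance \<sigma>" "0 \<le> t" "Suc (last_released \<sigma> t) < length \<sigma>"
  shows "t \<le> rel \<sigma> (Suc (last_released \<sigma> t))"
  using last_released(3)[OF assms(1,2,3)] by force

section \<open>Independence of the robots not yet revealed\<close>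

lemma plan_from_cong:
  assumes eq: "take (Suc j) \<sigma> = take (Suc j) \<tau>" and len: "j < length \<sigma>" "j < length \<tau>"
    and c: "\<And>k. k \<le> j \<Longrightarrow> c k = c' k" and i: "i \<le> j"
  shows "plan_from S G \<sigma> j c i t = plan_from S G \<tau> j c' i t"
proof -
  have nth: "\<sigma> ! k = \<tau> ! k" if "k \<le> j" for k
    using nth_take[of k "Suc j" \<sigma>] nth_take[of k "Suc j" \<tau>] eq that by simp
  have "(\<lambda>k. rel \<sigma> j + dist (c k) (pos \<sigma> k)) ` {..j} = (\<lambda>k. rel \<tau> j + dist (c' k) (pos \<tau> k)) ` {..j}"
    using nth c by (intro image_cong) auto
  then show ?thesis
    using nth[of i] nth[of j] c[of i] i unfolding plan_from_def by (simp add: eq Let_def)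
qed

lemma plan_append:
  "j < length \<rho> \<Longrightarrow> i \<le> j \<Longrightarrow> plan S G (\<rho> @ \<upsilon>) j i t = plan S G \<rho> j i t"
proof (induction j arbitrary: i t)
  case 0
  then show ?case by (auto intro!: plan_from_cong simp: nth_append Suc_le_eq)
next
  case (Suc j)
  then show ?case by (auto intro!: plan_from_cong simp: nth_append Suc_le_eq)
qed

text \<open>Robots released after \<open>t\<close> change neither the latest release at
  \<open>t\<close> nor the plans up to it, since plan \<open>j\<close> reads only the first
  \<open>j + 1\<close> entries.\<close>

lemma replanning_append:
  assumes inst: "freeze_instance (\<rho> @ \<upsilon>)" and late: "\<forall>r\<in>set \<upsilon>. t < snd r" and t: "0 \<le> t"
    and i: "i < length \<rho>"
  shows "replanning S G (\<rho> @ \<upsilon>) i t = replanning S G \<rho> i t"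
proof -
  have "j < length (\<rho> @ \<upsilon>) \<and> rel (\<rho> @ \<upsilon>) j \<le> t \<longleftrightarrow> j < length \<rho> \<and> rel \<rho> j \<le> t" for j
  proof (cases "j < length \<rho>")
    case False
    then have "t < rel (\<rho> @ \<upsilon>) j" if "j < length (\<rho> @ \<upsilon>)"
      using that late nth_mem[of "j - length \<rho>" \<upsilon>] by (simp add: nth_append)
    then show ?thesis using False by force
  qed (simp add: nth_append)
  then have l: "last_released (\<rho> @ \<upsilon>) t = last_released \<rho> t" by (simp add: last_released_def)
  have "freeze_instance \<rho>"
    using inst i by (cases "\<rho> = []") (auto simp: freeze_instance_def nth_append sorted_append)
  then have "last_released \<rho> t < length \<rho>" using last_released(1) t by blast
  then show ?thesis
    unfolding replanning_def l Let_def using i plan_append by (auto simp: nth_append)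
qed

lemma sorted_split_revealed:
  "sorted (map snd \<sigma>) \<Longrightarrow> \<sigma> = revealed \<sigma> t @ filter (\<lambda>r. t < snd r) \<sigma>"
proof (induction \<sigma>)
  case (Cons a \<sigma>)
  show ?case
  proof (cases "snd a \<le> t")
    case False
    then have "\<forall>r\<in>set (a # \<sigma>). t < snd r" using Cons.prems by auto
    then have "filter (\<lambda>r. t < snd r) (a # \<sigma>) = a # \<sigma>" "revealed (a # \<sigma>) t = []"
      by (force simp: revealed_def filter_empty_conv filter_id_conv)+
    then show ?thesis by simp
  qed (use Cons in \<open>auto simp: revealed_def\<close>)
qed (simp add: revealed_def)

text \<open>As release times are sorted, the revealed robots form a prefix, and the robots cut off
  are released after \<open>t\<close>, hence after \<open>s\<close>.\<close>

lemma replanning_revealed: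
  assumes inst: "freeze_instance \<sigma>" and s: "0 \<le> s" "s \<le> t" and i: "i < length (revealed \<sigma> t)"
  shows "replanning S G \<sigma> i s = replanning S G (revealed \<sigma> t) i s"
proof -
  let ?u = "filter (\<lambda>r. t < snd r) \<sigma>"
  have split: "\<sigma> = revealed \<sigma> t @ ?u"
    using inst by (intro sorted_split_revealed) (simp add: freeze_instance_def)
  have "replanning S G (revealed \<sigma> t @ ?u) i s = replanning S G (revealed \<sigma> t) i s"
    using s by (intro replanning_append i) (auto simp flip: split intro: inst)
  then show ?thesis by (simp flip: split)
qed

section \<open>A fixed realization: phases of a plan and distances from home\<close>

locale replanner =
  fixes S :: "'a::metric_space freeze_inst \<Rightarrow> 'a motion" and G :: "'a \<Rightarrow> 'a \<Rightarrow> real \<Rightarrow> 'a"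
  assumes optimal: "freeze_instance \<sigma> \<Longrightarrow> optimal_schedule \<sigma> (S \<sigma>)"
    and moves: "shortest_moves G"
begin

definition opt :: "'a freeze_inst \<Rightarrow> nat \<Rightarrow> real" where
  "opt \<sigma> j = real_of_ereal (OPT (take (Suc j) \<sigma>))"

text \<open>\<open>position \<sigma> j\<close> extends the plan adopted at the release of \<open>r\<^sub>j\<close> to the robots released later, so
  that consecutive plans agree at the release time for all robots.\<close>

definition position :: "'a freeze_inst \<Rightarrow> nat \<Rightarrow> 'a motion" where
  "position \<sigma> j i t = (if i \<le> j then plan S G \<sigma> j i t else pos \<sigma> i)"

definition start :: "'a freeze_inst \<Rightarrow> nat \<Rightarrow> nat \<Rightarrow> 'a" where
  "start \<sigma> j i = (case j of 0 \<Rightarrow> pos \<sigma> i | Suc k \<Rightarrow> position \<sigma> k i (rel \<sigma> j))"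

lemma plan_start: "plan S G \<sigma> j = plan_from S G \<sigma> j (start \<sigma> j)"
proof -
  have "start \<sigma> 0 = pos \<sigma>"
    "start \<sigma> (Suc k) = (\<lambda>i. if i \<le> k then plan S G \<sigma> k i (rel \<sigma> (Suc k)) else pos \<sigma> i)" for k
    by (simp_all add: fun_eq_iff start_def position_def)
  then show ?thesis by (cases j) simp_all
qed

lemma replanning_position: "replanning S G \<sigma> i t = position \<sigma> (last_released \<sigma> t) i t"
  by (simp add: replanning_def position_def)

lemma OPT_take:
  assumes "freeze_instance \<sigma>"
  shows "OPT (take (Suc j) \<sigma>) = ereal (opt \<sigma> j)"
  using optimal_schedule_exists[OF moves freeze_instance_take[OF assms], of j]
  by (auto simp: opt_def)

lemma subplan_schedule:
  "freeze_instance \<sigma> \<Longrightarrow> schedule (take (Suc j) \<sigma>) (S (take (Suc j) \<sigma>))"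
  using optimal[OF freeze_instance_take] by (simp add: optimal_schedule_def)

lemma subplan_active:
  assumes "freeze_instance \<sigma>" "j < length \<sigma>" "i \<le> j"
  shows "active (take (Suc j) \<sigma>) (S (take (Suc j) \<sigma>)) i (opt \<sigma> j)"
  using assms
  by (intro optimal_schedule_attained[OF optimal[OF freeze_instance_take] _ OPT_take])
     (auto simp: freeze_instance_def)

lemma subplan_initial:
  assumes "freeze_instance \<sigma>" "j < length \<sigma>" "i \<le> j"
  shows "S (take (Suc j) \<sigma>) i 0 = pos \<sigma> i"
  using subplan_schedule[OF assms(1), of j] assms by (simp add: schedule_def)

lemma subplan_lipschitz:
  assumes "freeze_instance \<sigma>" "j < length \<sigma>" "i \<le> j"
  shows "1-lipschitz_on {0..} (S (take (Suc j) \<sigma>) i)"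
  using subplan_schedule[OF assms(1), of j] assms by (simp add: schedule_def)

lemma subplan_dist:
  assumes "freeze_instance \<sigma>" "j < length \<sigma>" "i \<le> j" "0 \<le> s"
  shows "dist (S (take (Suc j) \<sigma>) i s) (pos \<sigma> i) \<le> s"
  using lipschitz_onD[OF subplan_lipschitz[OF assms(1-3)], of s 0] subplan_initial[OF assms(1-3)] assms(4)
  by (simp add: dist_real_def)

text \<open>The optimal schedule has \<open>r\<^sub>j\<close> active at time
  \<open>opt \<sigma> j\<close>, and nobody but \<open>r\<^sub>0\<close> can be active before its
  release.\<close>

lemma rel_le_opt:
  assumes "freeze_instance \<sigma>" "j < length \<sigma>"
  shows "rel \<sigma> j \<le> opt \<sigma> j"
proof (cases "j = 0")
  case True
  then show ?thesis
    using active_nonneg[OF subplan_active[OF assms, of j]] assms(1) by (simp add: freeze_instance_def)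
next
  case False
  then show ?thesis using active_released[OF subplan_active[OF assms, of j]] by simp
qed

lemma opt_nonneg: "freeze_instance \<sigma> \<Longrightarrow> j < length \<sigma> \<Longrightarrow> 0 \<le> opt \<sigma> j"
  using rel_le_opt rel_nonneg order.trans by blast

text \<open>Under \<open>near\<close> everybody is home in time, so the maximum in
  \<open>plan_from\<close> collapses to \<open>sqrt 2 * T\<close>. The formulas agree where phases
  meet, so each holds on a closed interval, as gluing requires.\<close>

lemma plan_phases:
  assumes inst: "freeze_instance \<sigma>" and j: "j < length \<sigma>" and ij: "i \<le> j"
    and near: "\<And>k. k \<le> j \<Longrightarrow> dist (start \<sigma> j k) (pos \<sigma> k) \<le> (sqrt 2 - 1) * rel \<sigma> j"
    and T: "T = opt \<sigma> j" and b: "b = sqrt 2 * T"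
  shows "rel \<sigma> j \<le> b"
    and "rel \<sigma> j \<le> t \<Longrightarrow> t \<le> b \<Longrightarrow> position \<sigma> j i t = G (start \<sigma> j i) (pos \<sigma> i) (t - rel \<sigma> j)"
    and "b \<le> t \<Longrightarrow> t \<le> b + T \<Longrightarrow> position \<sigma> j i t = S (take (Suc j) \<sigma>) i (t - b)"
    and "b + T \<le> t \<Longrightarrow>
           position \<sigma> j i t = G (S (take (Suc j) \<sigma>) i T) (pos \<sigma> i) (t - (b + T))"
proof -
  let ?S = "S (take (Suc j) \<sigma>)"
  have T0: "0 \<le> T" using opt_nonneg[OF inst j] T by simp
  have sb: "sqrt 2 * rel \<sigma> j \<le> b" using rel_le_opt[OF inst j] T b by simp
  \<comment> \<open>Here \<open>rel \<sigma> j + (sqrt 2 - 1) * rel \<sigma> j = sqrt 2 * rel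
    \<sigma> j\<close>, which is where the waiting factor \<open>sqrt 2\<close> enters.\<close>
  have home: "rel \<sigma> j + dist (start \<sigma> j k) (pos \<sigma> k) \<le> b" if "k \<le> j" for k
    using near[OF that] sb by (simp add: algebra_simps)
  show r: "rel \<sigma> j \<le> b" using home[OF ij] zero_le_dist[of "start \<sigma> j i" "pos \<sigma> i"] by linarith
  have "(MAX k\<in>{..j}. rel \<sigma> j + dist (start \<sigma> j k) (pos \<sigma> k)) \<le> b"
    using home by (intro Max.boundedI) auto
  then have max: "max (sqrt 2 * T) (MAX k\<in>{..j}. rel \<sigma> j + dist (start \<sigma> j k) (pos \<sigma> k)) = b"
    using b by simp
  have p: "position \<sigma> j i t =
     (if t \<le> b then G (start \<sigma> j i) (pos \<sigma> i) (t - rel \<sigma> j)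
      else if t \<le> b + T then ?S i (t - b) else G (?S i T) (pos \<sigma> i) (t - (b + T)))" for t
    using ij max T[unfolded opt_def] unfolding position_def plan_start plan_from_def Let_def by simp
  show "rel \<sigma> j \<le> t \<Longrightarrow> t \<le> b \<Longrightarrow> position \<sigma> j i t = G (start \<sigma> j i) (pos \<sigma> i) (t - rel \<sigma> j)"
    by (simp add: p)
  have pb: "position \<sigma> j i b = pos \<sigma> i"
    using home[OF ij] by (simp add: p shortest_movesD(2)[OF moves])
  show 3: "position \<sigma> j i t = ?S i (t - b)" if "b \<le> t" "t \<le> b + T" for t
    using that pb subplan_initial[OF inst j ij] by (cases "t = b") (auto simp: p)
  show "b + T \<le> t \<Longrightarrow> position \<sigma> j i t = G (?S i T) (pos \<sigma> i) (t - (b + T))"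
    using 3[of "b + T"] T0 by (cases "t = b + T") (auto simp: p shortest_movesD(1)[OF moves])
qed

text \<open>The optimal value of the revealed instance may decrease when a robot is released.  Nevertheless,
  a robot is never further than \<open>(sqrt 2 - 1) * t\<close> from home at time \<open>t\<close>, and since
  \<open>rel \<sigma> j \<le> opt \<sigma> j\<close>, everybody is home again by time \<open>sqrt 2 * opt \<sigma> j\<close>.\<close>

lemma position_near_step:
  assumes inst: "freeze_instance \<sigma>" and j: "j < length \<sigma>" and t: "rel \<sigma> j \<le> t"
    and near: "\<And>k. k \<le> j \<Longrightarrow> dist (start \<sigma> j k) (pos \<sigma> k) \<le> (sqrt 2 - 1) * rel \<sigma> j"
  shows "dist (position \<sigma> j i t) (pos \<sigma> i) \<le> (sqrt 2 - 1) * t"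
proof (cases "i \<le> j")
  case False
  have "0 \<le> t" using rel_nonneg[OF inst j] t by linarith
  then show ?thesis using False by (simp add: position_def)
next
  case ij: True
  define T where "T = opt \<sigma> j"
  define b where "b = sqrt 2 * T"
  note ph = plan_phases[OF inst j ij near T_def b_def]
  have T0: "0 \<le> T" using opt_nonneg[OF inst j] T_def by simp
  have sq: "sqrt 2 * sqrt 2 = (2::real)" by simp
  have s1: "1 \<le> sqrt (2::real)" "sqrt (2::real) \<le> 2" using real_le_lsqrt[of 2 2] by auto
  \<comment> \<open>This is \<open>(sqrt 2 - 1) * (sqrt 2 + 1) = 1\<close>, multiplied by
    \<open>T\<close>.\<close>
  have bT: "(sqrt 2 - 1) * (b + T) = T" using sq by (simp add: b_def algebra_simps)
  consider "t \<le> b" | "b \<le> t" "t \<le> b + T" | "b + T \<le> t" by linarith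
  then show ?thesis
  proof cases
    case 1
    have "dist (position \<sigma> j i t) (pos \<sigma> i) \<le> max 0 (dist (start \<sigma> j i) (pos \<sigma> i) - (t - rel \<sigma> j))"
      using ph(2)[OF _ t 1] shortest_moves_dist[OF moves] t by simp
    also have "\<dots> \<le> (sqrt 2 - 1) * rel \<sigma> j"
      using near[OF ij] t s1 rel_nonneg[OF inst j] by auto
    also have "\<dots> \<le> (sqrt 2 - 1) * t" using t s1 by (intro mult_left_mono) auto
    finally show ?thesis .
  next
    case 2
    have "dist (position \<sigma> j i t) (pos \<sigma> i) \<le> t - b"
      using ph(3)[OF _ 2] subplan_dist[OF inst j ij] 2 by simp
    \<comment> \<open>The goal \<open>t - b \<le> (sqrt 2 - 1) * t\<close> amounts to
      \<open>(2 - sqrt 2) * t \<le> b\<close>, with equality at the end \<open>b + T\<close> of the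
      phase.\<close>
    moreover have "(2 - sqrt 2) * t \<le> (2 - sqrt 2) * (b + T)" using 2 s1 by (intro mult_left_mono) auto
    moreover have "(2 - sqrt 2) * (b + T) = b" using sq by (simp add: b_def algebra_simps)
    ultimately show ?thesis by (simp add: algebra_simps)
  next
    case 3
    have "dist (position \<sigma> j i t) (pos \<sigma> i)
        \<le> max 0 (dist (S (take (Suc j) \<sigma>) i T) (pos \<sigma> i) - (t - (b + T)))"
      using ph(4)[OF _ 3] shortest_moves_dist[OF moves] 3 by simp
    also have "\<dots> \<le> T" using subplan_dist[OF inst j ij T0] 3 T0 by auto
    also have "\<dots> = (sqrt 2 - 1) * (b + T)" by (simp only: bT)
    also have "\<dots> \<le> (sqrt 2 - 1) * t" using 3 s1 by (intro mult_left_mono) auto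
    finally show ?thesis .
  qed
qed

text \<open>Induction over the releases: the bound that one plan guarantees at the next release is
  the hypothesis \<open>near\<close> for the next plan.\<close>

lemma start_near:
  assumes "freeze_instance \<sigma>" "j < length \<sigma>"
  shows "dist (start \<sigma> j i) (pos \<sigma> i) \<le> (sqrt 2 - 1) * rel \<sigma> j"
  using assms(2)
proof (induction j arbitrary: i)
  case 0
  then show ?case using assms(1) by (simp add: start_def freeze_instance_def)
next
  case (Suc j)
  then show ?case
    using position_near_step[OF assms(1), of j "rel \<sigma> (Suc j)" i] rel_mono[OF assms(1), of j "Suc j"]
    by (simp add: start_def)
qed

lemma position_start:
  assumes "freeze_instance \<sigma>" "j < length \<sigma>"
  shows "position \<sigma> j i (rel \<sigma> j) = start \<sigma> j i"
proof (cases "i \<le> j")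
  case True
  then show ?thesis
    using plan_phases(1,2)[OF assms True start_near[OF assms] refl refl] shortest_movesD(1)[OF moves]
    by simp
next
  case False
  then show ?thesis by (cases j) (simp_all add: start_def position_def)
qed

section \<open>Speed bound and legality of the motion\<close>

lemma position_lipschitz:
  assumes inst: "freeze_instance \<sigma>" and j: "j < length \<sigma>"
  shows "1-lipschitz_on {rel \<sigma> j..} (position \<sigma> j i)"
proof (cases "i \<le> j")
  case False
  then show ?thesis by (intro lipschitz_onI) (auto simp: position_def)
next
  case ij: True
  define T where "T = opt \<sigma> j"
  define b where "b = sqrt 2 * T"
  note ph = plan_phases[OF inst j ij start_near[OF inst j] T_def b_def]
  have T0: "0 \<le> T" using opt_nonneg[OF inst j] T_def by simp
  note G = shortest_movesD(3)[OF moves]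
  show ?thesis
  proof (rule lipschitz_on_glue[where b = b])
    have "1-lipschitz_on ({rel \<sigma> j..} \<inter> {..b}) (\<lambda>t. G (start \<sigma> j i) (pos \<sigma> i) (t - rel \<sigma> j))"
      using lipschitz_on_shift[OF G] by (rule lipschitz_on_subset) auto
    then show "1-lipschitz_on ({rel \<sigma> j..} \<inter> {..b}) (position \<sigma> j i)"
      by (rule lipschitz_on_transform) (simp add: ph(2))
    have "1-lipschitz_on {b..} (position \<sigma> j i)"
    proof (rule lipschitz_on_glue[where b = "b + T"])
      have "1-lipschitz_on ({b..} \<inter> {..b + T}) (\<lambda>t. S (take (Suc j) \<sigma>) i (t - b))"
        using lipschitz_on_shift[OF subplan_lipschitz[OF inst j ij]] by (rule lipschitz_on_subset) auto
      then show "1-lipschitz_on ({b..} \<inter> {..b + T}) (position \<sigma> j i)"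
        by (rule lipschitz_on_transform) (simp add: ph(3))
      have "1-lipschitz_on ({b..} \<inter> {b + T..})
          (\<lambda>t. G (S (take (Suc j) \<sigma>) i T) (pos \<sigma> i) (t - (b + T)))"
        using lipschitz_on_shift[OF G] by (rule lipschitz_on_subset) auto
      then show "1-lipschitz_on ({b..} \<inter> {b + T..}) (position \<sigma> j i)"
        by (rule lipschitz_on_transform) (simp add: ph(4))
    qed (use T0 in simp)
    then show "1-lipschitz_on ({rel \<sigma> j..} \<inter> {b..}) (position \<sigma> j i)"
      by (rule lipschitz_on_subset) auto
  qed (use ph(1) in simp)
qed

text \<open>The right end point is included although a later plan is already followed there. All
  plans adopted at that moment agree at it by \<open>position_start\<close>, even if several robots
  are released simultaneously.\<close>

lemma replanning_eq_position:
  assumes inst: "freeze_instance \<sigma>" and j: "j < length \<sigma>"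
    and t: "rel \<sigma> j \<le> t" "Suc j < length \<sigma> \<Longrightarrow> t \<le> rel \<sigma> (Suc j)"
  shows "replanning S G \<sigma> i t = position \<sigma> j i t"
proof -
  have t0: "0 \<le> t" using rel_nonneg[OF inst j] t(1) by linarith
  note l = last_released[OF inst t0]
  have "position \<sigma> k i t = position \<sigma> j i t" if "j \<le> k" "k \<le> last_released \<sigma> t" for k
    using that
  proof (induction k rule: dec_induct)
    case (step k)
    have "rel \<sigma> (Suc k) \<le> t" using rel_mono[OF inst step(4) l(1)] l(2) by linarith
    moreover have "rel \<sigma> (Suc j) \<le> rel \<sigma> (Suc k)" "t \<le> rel \<sigma> (Suc j)"
      using step l(1) by (auto intro!: rel_mono[OF inst] t(2))
    ultimately have "t = rel \<sigma> (Suc k)" by linarith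
    then have "position \<sigma> (Suc k) i t = position \<sigma> k i t"
      using position_start[OF inst, of "Suc k" i] step l(1) by (simp add: start_def)
    then show ?case using step by simp
  qed simp
  moreover have "j \<le> last_released \<sigma> t" using l(3) j t(1) by blast
  ultimately show ?thesis unfolding replanning_position by blast
qed

lemma replanning_near:
  assumes inst: "freeze_instance \<sigma>" and "0 \<le> t"
  shows "dist (replanning S G \<sigma> i t) (pos \<sigma> i) \<le> (sqrt 2 - 1) * t"
  unfolding replanning_position
  using last_released[OF assms] by (intro position_near_step start_near inst) auto

lemma replanning_lipschitz:
  assumes inst: "freeze_instance \<sigma>"
  shows "1-lipschitz_on {0..} (replanning S G \<sigma> i)"
proof -
  have pre: "1-lipschitz_on {0..rel \<sigma> j} (replanning S G \<sigma> i)" if "j < length \<sigma>" for j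
    using that
  proof (induction j)
    case 0
    have "{0..rel \<sigma> 0} = {0}" using inst by (simp add: freeze_instance_def)
    then show ?case by (simp add: lipschitz_on_singleton)
  next
    case (Suc j)
    have j: "j < length \<sigma>" using Suc by simp
    show ?case
    proof (rule lipschitz_on_glue[where b = "rel \<sigma> j"])
      show "1-lipschitz_on ({0..rel \<sigma> (Suc j)} \<inter> {..rel \<sigma> j}) (replanning S G \<sigma> i)"
        using Suc.IH[OF j] by (rule lipschitz_on_subset) auto
      have "1-lipschitz_on ({0..rel \<sigma> (Suc j)} \<inter> {rel \<sigma> j..}) (position \<sigma> j i)"
        using position_lipschitz[OF inst j] by (rule lipschitz_on_subset) auto
      then show "1-lipschitz_on ({0..rel \<sigma> (Suc j)} \<inter> {rel \<sigma> j..}) (replanning S G \<sigma> i)"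
        by (rule lipschitz_on_transform) (simp add: replanning_eq_position[OF inst j])
      show "rel \<sigma> j \<in> {0..rel \<sigma> (Suc j)}"
        using rel_nonneg[OF inst j] rel_mono[OF inst, of j "Suc j"] Suc.prems by simp
    qed
  qed
  \<comment> \<open>The plan of the last robot is never replaced and covers all remaining
    times.\<close>
  define j where "j = length \<sigma> - 1"
  have j: "j < length \<sigma>" "\<not> Suc j < length \<sigma>"
    using inst by (auto simp: j_def freeze_instance_def)
  show ?thesis
  proof (rule lipschitz_on_glue[where b = "rel \<sigma> j"])
    show "1-lipschitz_on ({0..} \<inter> {..rel \<sigma> j}) (replanning S G \<sigma> i)"
      using pre[OF j(1)] by (rule lipschitz_on_subset) auto
    have "1-lipschitz_on ({0..} \<inter> {rel \<sigma> j..}) (position \<sigma> j i)"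
      using position_lipschitz[OF inst j(1)] by (rule lipschitz_on_subset) auto
    then show "1-lipschitz_on ({0..} \<inter> {rel \<sigma> j..}) (replanning S G \<sigma> i)"
      by (rule lipschitz_on_transform) (use j in \<open>simp add: replanning_eq_position[OF inst j(1)]\<close>)
  qed (use rel_nonneg[OF inst j(1)] in simp)
qed

text \<open>As long as the plan of \<open>r\<^sub>j\<close> is in effect, its phase (3) copies the optimal schedule with a delay
  of \<open>sqrt 2 * opt \<sigma> j\<close>, and the delay does no harm to release times.\<close>

lemma active_delayed:
  assumes inst: "freeze_instance \<sigma>" and j: "j < length \<sigma>"
    and "active (take (Suc j) \<sigma>) (S (take (Suc j) \<sigma>)) i s" "s \<le> opt \<sigma> j"
    and "Suc j < length \<sigma> \<Longrightarrow> sqrt 2 * opt \<sigma> j + s \<le> rel \<sigma> (Suc j)"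
  shows "active \<sigma> (replanning S G \<sigma>) i (sqrt 2 * opt \<sigma> j + s)"
  using assms(3-)
proof (induction rule: active.induct)
  case (initial t)
  then show ?case using opt_nonneg[OF inst j] by (auto intro!: active.initial)
next
  case (visited w s i t)
  let ?b = "sqrt 2 * opt \<sigma> j"
  have b0: "0 \<le> ?b" using opt_nonneg[OF inst j] by simp
  have s0: "0 \<le> s" using visited(1) by (rule active_nonneg)
  have w: "w \<le> j" using active_index[OF visited(1)] by auto
  have i: "i \<le> j" "i < length \<sigma>" using visited(2) j by auto
  note ph = plan_phases[OF inst j w start_near[OF inst j] refl refl]
  \<comment> \<open>Since \<open>s \<le> t\<close>, both upper bounds on \<open>t\<close> hold for
    \<open>s\<close> too: the plan of \<open>r\<^sub>j\<close> is in effect and in phase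
    (3).\<close>
  have "replanning S G \<sigma> w (?b + s) = position \<sigma> j w (?b + s)"
    using visited.prems visited.hyps ph(1) s0 by (intro replanning_eq_position[OF inst j]) auto
  also have "\<dots> = S (take (Suc j) \<sigma>) w s"
    using ph(3)[of "?b + s"] s0 visited.prems visited.hyps by simp
  also have "\<dots> = pos \<sigma> i" using visited(4) i by simp
  finally have "replanning S G \<sigma> w (?b + s) = pos \<sigma> i" .
  moreover have "active \<sigma> (replanning S G \<sigma>) w (?b + s)"
    using visited.IH visited.prems visited.hyps by force
  moreover have "rel \<sigma> i \<le> ?b + s" using visited(3) i b0 by simp
  ultimately show ?case
    using i(2) visited.hyps by (intro active.visited[of \<sigma> _ w "?b + s" i]) auto
qed

text \<open>A robot that is away on its way home was away when the plan was adopted, as a shortest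
  move from a point to itself is constant. In phase (3) legality of the optimal schedule applies,
  shifted in time, and afterwards everybody is active.\<close>

lemma moved_active_step:
  assumes inst: "freeze_instance \<sigma>" and j: "j < length \<sigma>"
    and t: "rel \<sigma> j \<le> t" "Suc j < length \<sigma> \<Longrightarrow> t \<le> rel \<sigma> (Suc j)"
    and st: "start \<sigma> j i \<noteq> pos \<sigma> i \<Longrightarrow> active \<sigma> (replanning S G \<sigma>) i (rel \<sigma> j)"
    and moved: "position \<sigma> j i t \<noteq> pos \<sigma> i"
  shows "active \<sigma> (replanning S G \<sigma>) i t"
proof -
  have ij: "i \<le> j" using moved by (auto simp: position_def split: if_splits)
  define T where "T = opt \<sigma> j"
  define b where "b = sqrt 2 * T"
  note ph = plan_phases[OF inst j ij start_near[OF inst j] T_def b_def]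
  have T0: "0 \<le> T" using opt_nonneg[OF inst j] T_def by simp
  note delayed = active_delayed[OF inst j, folded T_def, folded b_def]
  consider "t \<le> b" | "b \<le> t" "t \<le> b + T" | "b + T \<le> t" by linarith
  then show ?thesis
  proof cases
    case 1
    then have "start \<sigma> j i \<noteq> pos \<sigma> i"
      using moved ph(2)[OF t(1) 1] shortest_moves_const[OF moves] t(1) by auto
    then show ?thesis using st t(1) by (auto intro: active_mono)
  next
    case 2
    have "S (take (Suc j) \<sigma>) i (t - b) = pos \<sigma> i"
      if "\<not> active (take (Suc j) \<sigma>) (S (take (Suc j) \<sigma>)) i (t - b)"
      using subplan_schedule[OF inst, of j] that 2 ij j by (simp add: schedule_def)
    then have "active (take (Suc j) \<sigma>) (S (take (Suc j) \<sigma>)) i (t - b)"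
      using moved ph(3) 2 by auto
    then show ?thesis using delayed[of i "t - b"] 2 t(2) by simp
  next
    case 3
    have "active \<sigma> (replanning S G \<sigma>) i (b + T)"
      using 3 t(2) subplan_active[OF inst j ij] by (intro delayed) (auto simp: T_def)
    then show ?thesis using 3 by (rule active_mono)
  qed
qed

lemma start_moved_active:
  assumes inst: "freeze_instance \<sigma>" and "j < length \<sigma>" "start \<sigma> j i \<noteq> pos \<sigma> i"
  shows "active \<sigma> (replanning S G \<sigma>) i (rel \<sigma> j)"
  using assms(2,3)
proof (induction j)
  case 0
  then show ?case by (simp add: start_def)
next
  case (Suc j)
  show ?case
    by (rule moved_active_step[OF inst, of j])
      (use Suc rel_mono[OF inst, of j "Suc j"] in \<open>simp_all add: start_def\<close>)
qed

lemma replanning_schedule: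
  assumes inst: "freeze_instance \<sigma>"
  shows "schedule \<sigma> (replanning S G \<sigma>)"
  unfolding schedule_def
proof (intro allI impI conjI)
  fix i
  \<comment> \<open>The bound \<open>(sqrt 2 - 1) * t\<close> on the distance from home is 0 at time
    0.\<close>
  show "replanning S G \<sigma> i 0 = pos \<sigma> i" using replanning_near[OF inst, of 0 i] by simp
  show "1-lipschitz_on {0..} (replanning S G \<sigma> i)" using inst by (rule replanning_lipschitz)
next
  fix i t assume t: "t \<ge> 0" and na: "\<not> active \<sigma> (replanning S G \<sigma>) i t"
  note l = last_released[OF inst t]
  show "replanning S G \<sigma> i t = pos \<sigma> i"
    using na moved_active_step[OF inst l(1,2) last_released_interval[OF inst t]]
      start_moved_active[OF inst l(1)]
    unfolding replanning_position by blast
qed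

section \<open>Online property and competitive ratio\<close>

lemma replanning_online: "online_algorithm (replanning S G)"
  unfolding online_algorithm_def
proof (intro conjI allI impI ballI)
  fix \<sigma> \<tau> :: "'a freeze_inst" and t i s
  assume H: "freeze_instance \<sigma> \<and> freeze_instance \<tau> \<and> 0 \<le> t \<and> revealed \<sigma> t = revealed \<tau> t"
    and i: "i < length (revealed \<sigma> t)" and s: "s \<in> {0..t}"
  \<comment> \<open>Both motions are compared with the one for the common revealed prefix.\<close>
  have "replanning S G \<sigma> i s = replanning S G (revealed \<sigma> t) i s"
    using H i s by (intro replanning_revealed) auto
  also have "\<dots> = replanning S G \<tau> i s"
    using H i s replanning_revealed[of \<tau> s t i S G] by simp
  finally show "replanning S G \<sigma> i s = replanning S G \<tau> i s" .
qed (rule replanning_schedule)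

lemma replanning_competitive: "competitive (1 + sqrt 2) (replanning S G)"
  unfolding competitive_def
proof (intro allI impI)
  fix \<sigma> :: "'a freeze_inst" assume inst: "freeze_instance \<sigma>"
  define j where "j = length \<sigma> - 1"
  have ne: "\<sigma> \<noteq> []" using inst by (simp add: freeze_instance_def)
  then have j: "j < length \<sigma>" "\<not> Suc j < length \<sigma>" "take (Suc j) \<sigma> = \<sigma>" by (auto simp: j_def)
  \<comment> \<open>No release follows \<open>r\<^sub>j\<close>, so its plan runs to the end;
    \<open>active_delayed\<close> is applied at the full optimum.\<close>
  have "active \<sigma> (replanning S G \<sigma>) i (sqrt 2 * opt \<sigma> j + opt \<sigma> j)" if "i < length \<sigma>" for i
    using that j subplan_active[OF inst j(1)] by (intro active_delayed[OF inst j(1)]) auto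
  from completion_time_le[OF ne this]
  show "completion_time \<sigma> (replanning S G \<sigma>) \<le> ereal (1 + sqrt 2) * OPT \<sigma>"
    using OPT_take[OF inst, of j] j(3) by (simp add: algebra_simps)
qed

end

text \<open>The first conjunct keeps the second from being vacuous; it rests on the existence of
  shortest moves and of optimal schedules. The second covers every choice of \<open>S\<close> and
  \<open>G\<close>.\<close>

theorem theorem2:
  assumes "strongly_connected (UNIV :: 'a::metric_space set)"
  shows "(replanning_algorithms :: ('a freeze_inst \<Rightarrow> 'a motion) set) \<noteq> {} \<and>
    (\<forall>A \<in> (replanning_algorithms :: ('a freeze_inst \<Rightarrow> 'a motion) set).
       online_algorithm A \<and> competitive (1 + sqrt 2) A)"
proof
  obtain G :: "'a \<Rightarrow> 'a \<Rightarrow> real \<Rightarrow> 'a" where G: "shortest_moves G"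
    using shortest_moves_exist[OF assms] by blast
  have "\<exists>S :: 'a freeze_inst \<Rightarrow> 'a motion. \<forall>\<sigma>. freeze_instance \<sigma> \<longrightarrow> optimal_schedule \<sigma> (S \<sigma>)"
    using optimal_schedule_exists[OF G] by metis
  then show "(replanning_algorithms :: ('a freeze_inst \<Rightarrow> 'a motion) set) \<noteq> {}"
    using G unfolding replanning_algorithms_def by blast
  show "\<forall>A \<in> (replanning_algorithms :: ('a freeze_inst \<Rightarrow> 'a motion) set).
       online_algorithm A \<and> competitive (1 + sqrt 2) A"
  proof
    fix A :: "'a freeze_inst \<Rightarrow> 'a motion" assume "A \<in> replanning_algorithms"
    then obtain S G where A: "A = replanning S G" and "replanner S G"
      unfolding replanning_algorithms_def replanner_def by blast
    then show "online_algorithm A \<and> competitive (1 + sqrt 2) A"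
      using replanner.replanning_online replanner.replanning_competitive by blast
  qed
qed

end
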